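(* Let $N\ge3$, $k>0$, $\alpha>\frac{N+1}{2}$, and let $f:\mathbb{R}^N\times\mathbb{C}\to\mathbb{C}$ be a continuous function satisfying $$\sup_{|u|\le M,\,x\in\mathbb{R}^N}\langle x\rangle^\alpha|f(x,u)|<\infty\qquad\text{for all } M>0.$$ Suppose moreover that $f(x,\cdot):\mathbb{C}\to\mathbb{C}$ is real differentiable for every $x\in\mathbb{R}^N$, and that $f':=\partial_uf:\mathbb{R}^N\times\mathbb{C}\to\mathcal{L}_{\mathbb{R}}(\mathbb{C},\mathbb{C})$ is a continuous function satisfying $$\sup_{|u|\le M,\,x\in\mathbb{R}^N}\langle x\rangle^\alpha\|f'(x,u)\|_{\mathcal{L}_{\mathbb{R}}(\mathbb{C},\mathbb{C})}<\infty\qquad\text{for all } M>0.$$ Finally, suppose that $f(x,0)=0$ and $f'(x,0)=0\in\mathcal{L}_{\mathbb{R}}(\mathbb{C},\mathbb{C})$ for all $x\in\mathbb{R}^N$. Then there exist open neighborhoods $U,V\subset L^\infty(\mathbb{R}^N)$ of zero with the property that for every $\varphi\in V$ there exists a unique solution $u=u_\varphi\in U$ of $$u=\mathcal{R}_k(N_f(u))+\varphi .$$ Moreover, the map $V\to U$, $\varphi\mapsto u_\varphi$ is of class $C^1$.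
   Context: $L^\infty(\mathbb{R}^N)$ consists of complex-valued functions and is regarded as a real Banach space for differentiability; $\langle x\rangle=(1+|x|^2)^{1/2}$. $\mathcal{L}_{\mathbb{R}}(\mathbb{C},\mathbb{C})$ is the space of real-linear maps $\mathbb{C}\to\mathbb{C}$ with the operator norm. The outgoing fundamental solution is $$\Phi_k(x)=\frac{i}{4}\Big(\frac{k}{2\pi|x|}\Big)^{\frac{N-2}{2}}H^{(1)}_{\frac{N-2}{2}}(k|x|),\qquad x\in\mathbb{R}^N\setminus\{0\},$$ where $H^{(1)}_\nu$ is the Hankel function of the first kind of order $\nu$, and $\mathcal{R}_kf=\Phi_k*f$. $N_f$ is the substitution operator $N_f(u)(x)=f(x,u(x))$. *)

theory Defs
  imports "HOL-Analysis.Analysis" "HOL-Probability.Essential_Supremum"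
begin

section \<open>The Banach space of essentially bounded complex-valued functions\<close>

definition ess_norm :: "('a::euclidean_space \<Rightarrow> complex) \<Rightarrow> ereal" where
  "ess_norm f = esssup lebesgue (\<lambda>x. ereal (cmod (f x)))"

definition ess_bounded :: "('a::euclidean_space \<Rightarrow> complex) \<Rightarrow> bool" where
  "ess_bounded f \<longleftrightarrow> f \<in> borel_measurable lebesgue \<and> ess_norm f < \<infinity>"

definition linf_rel :: "('a::euclidean_space \<Rightarrow> complex) \<Rightarrow> ('a \<Rightarrow> complex) \<Rightarrow> bool" where
  "linf_rel f g \<longleftrightarrow> ess_bounded f \<and> ess_bounded g \<and> (AE x in lebesgue. f x = g x)"

lemma ess_bounded_iff:
  "ess_bounded f \<longleftrightarrow>
     f \<in> borel_measurable lebesgue \<and> (\<exists>C\<ge>0. AE x in lebesgue. cmod (f x) \<le> C)"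
proof (intro iffI conjI; (elim conjE)?)
  assume f: "ess_bounded f"
  then show "f \<in> borel_measurable lebesgue" by (simp add: ess_bounded_def)
  have "AE x in lebesgue. ereal (cmod (f x)) \<le> ess_norm f"
    unfolding ess_norm_def by (rule esssup_AE)
  then have "AE x in lebesgue. cmod (f x) \<le> max 0 (real_of_ereal (ess_norm f))"
  proof eventually_elim
    case (elim x)
    with f show ?case by (cases "ess_norm f") (auto simp: ess_bounded_def)
  qed
  then show "\<exists>C\<ge>0. AE x in lebesgue. cmod (f x) \<le> C"
    by (intro exI[of _ "max 0 (real_of_ereal (ess_norm f))"]) simp
next
  assume f [measurable]: "f \<in> borel_measurable lebesgue"
    and "\<exists>C\<ge>0. AE x in lebesgue. cmod (f x) \<le> C"
  then obtain C where "AE x in lebesgue. cmod (f x) \<le> C" by blast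
  then have "AE x in lebesgue. ereal (cmod (f x)) \<le> ereal C" by simp
  then have "ess_norm f \<le> ereal C"
    unfolding ess_norm_def by (intro esssup_I) measurable
  then have "ess_norm f < \<infinity>" by (rule le_less_trans) simp
  with f show "ess_bounded f" by (simp add: ess_bounded_def)
qed

lemma ess_bounded_add: "ess_bounded f \<Longrightarrow> ess_bounded g \<Longrightarrow> ess_bounded (\<lambda>x. f x + g x)"
proof -
  assume f: "ess_bounded f" and g: "ess_bounded g"
  then obtain C D where CD: "0 \<le> C" "0 \<le> D"
    "AE x in lebesgue. cmod (f x) \<le> C" "AE x in lebesgue. cmod (g x) \<le> D"
    by (auto simp: ess_bounded_iff)
  from CD(3,4) have "AE x in lebesgue. cmod (f x + g x) \<le> C + D"
    by eventually_elim (rule norm_triangle_mono)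
  moreover have "(\<lambda>x. f x + g x) \<in> borel_measurable lebesgue"
    using f g by (auto simp: ess_bounded_def intro: borel_measurable_add)
  ultimately show ?thesis
    using CD(1,2) unfolding ess_bounded_iff by (auto intro!: exI[of _ "C + D"])
qed

lemma ess_bounded_scaleR: "ess_bounded f \<Longrightarrow> ess_bounded (\<lambda>x. c *\<^sub>R f x)"
proof -
  assume f: "ess_bounded f"
  then obtain C where C: "0 \<le> C" "AE x in lebesgue. cmod (f x) \<le> C"
    by (auto simp: ess_bounded_iff)
  from C(2) have "AE x in lebesgue. cmod (c *\<^sub>R f x) \<le> \<bar>c\<bar> * C"
    by eventually_elim (simp add: mult_left_mono)
  moreover have "(\<lambda>x. c *\<^sub>R f x) \<in> borel_measurable lebesgue"
    using f by (auto simp: ess_bounded_def intro: borel_measurable_scaleR)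
  ultimately show ?thesis
    using C(1) unfolding ess_bounded_iff by (auto intro!: exI[of _ "\<bar>c\<bar> * C"])
qed

lemma ess_bounded_zero: "ess_bounded (\<lambda>x. 0)"
  by (auto simp: ess_bounded_iff)

lemma linf_rel_part_equivp:
  "part_equivp (linf_rel :: ('a::euclidean_space \<Rightarrow> complex) \<Rightarrow> _)" (is "part_equivp ?R")
proof (rule part_equivpI)
  show "\<exists>f. ?R f f"
    using ess_bounded_zero by (auto simp: linf_rel_def)
  show "symp ?R"
    by (auto simp: symp_def linf_rel_def elim: eventually_mono)
  show "transp ?R"
  proof (rule transpI)
    fix f g h :: "'a \<Rightarrow> complex"
    assume fg: "linf_rel f g" and gh: "linf_rel g h"
    then have "AE x in lebesgue. f x = g x" "AE x in lebesgue. g x = h x"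
      by (auto simp: linf_rel_def)
    then have "AE x in lebesgue. f x = h x" by eventually_elim simp
    with fg gh show "linf_rel f h" by (simp add: linf_rel_def)
  qed
qed

quotient_type (overloaded) 'a linf = "'a::euclidean_space \<Rightarrow> complex" / partial: linf_rel
  by (rule linf_rel_part_equivp)

instantiation linf :: (euclidean_space) real_normed_vector
begin

lift_definition zero_linf :: "'a linf" is "\<lambda>x. 0"
  by (simp add: linf_rel_def ess_bounded_zero)

lift_definition plus_linf :: "'a linf \<Rightarrow> 'a linf \<Rightarrow> 'a linf" is "\<lambda>f g x. f x + g x"
proof -
  fix f1 f2 g1 g2 :: "'a \<Rightarrow> complex"
  assume a: "linf_rel f1 f2" "linf_rel g1 g2"
  then have "AE x in lebesgue. f1 x = f2 x" "AE x in lebesgue. g1 x = g2 x"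
    by (auto simp: linf_rel_def)
  then have "AE x in lebesgue. f1 x + g1 x = f2 x + g2 x" by eventually_elim simp
  with a show "linf_rel (\<lambda>x. f1 x + g1 x) (\<lambda>x. f2 x + g2 x)"
    by (simp add: linf_rel_def ess_bounded_add)
qed

lift_definition scaleR_linf :: "real \<Rightarrow> 'a linf \<Rightarrow> 'a linf" is "\<lambda>c f x. c *\<^sub>R f x"
proof -
  fix c and f1 f2 :: "'a \<Rightarrow> complex"
  assume a: "linf_rel f1 f2"
  then have "AE x in lebesgue. f1 x = f2 x" by (auto simp: linf_rel_def)
  then have "AE x in lebesgue. c *\<^sub>R f1 x = c *\<^sub>R f2 x" by eventually_elim simp
  with a show "linf_rel (\<lambda>x. c *\<^sub>R f1 x) (\<lambda>x. c *\<^sub>R f2 x)"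
    using ess_bounded_scaleR[of f1 c] ess_bounded_scaleR[of f2 c]
    unfolding linf_rel_def by blast
qed

definition uminus_linf :: "'a linf \<Rightarrow> 'a linf" where
  "uminus_linf u = (- 1) *\<^sub>R u"

definition minus_linf :: "'a linf \<Rightarrow> 'a linf \<Rightarrow> 'a linf" where
  "minus_linf u v = u + (- v)"

lift_definition norm_linf :: "'a linf \<Rightarrow> real" is "\<lambda>f. real_of_ereal (ess_norm f)"
proof -
  fix f g :: "'a \<Rightarrow> complex"
  assume a: "linf_rel f g"
  then have [measurable]: "f \<in> borel_measurable lebesgue" "g \<in> borel_measurable lebesgue"
    by (auto simp: linf_rel_def ess_bounded_def)
  from a have "AE x in lebesgue. f x = g x" by (simp add: linf_rel_def)
  then have "AE x in lebesgue. ereal (cmod (f x)) = ereal (cmod (g x))"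
    by eventually_elim simp
  then have "ess_norm f = ess_norm g"
    unfolding ess_norm_def by (intro esssup_AE_cong) measurable
  then show "real_of_ereal (ess_norm f) = real_of_ereal (ess_norm g)" by simp
qed

definition dist_linf :: "'a linf \<Rightarrow> 'a linf \<Rightarrow> real" where
  "dist_linf u v = norm (u - v)"

definition sgn_linf :: "'a linf \<Rightarrow> 'a linf" where
  "sgn_linf u = inverse (norm u) *\<^sub>R u"

definition uniformity_linf :: "('a linf \<times> 'a linf) filter" where
  "uniformity_linf = (INF e\<in>{0 <..}. principal {(u, v). dist u v < e})"

definition open_linf :: "'a linf set \<Rightarrow> bool" where
  "open_linf S = (\<forall>u\<in>S. \<forall>\<^sub>F (v, w) in uniformity. v = u \<longrightarrow> w \<in> S)"

lemma rep_linf_rel: "linf_rel (rep_linf u) (rep_linf (u :: 'a linf))"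
  by (rule Quotient_rep_reflp[OF Quotient_linf])

lemma rep_linf_bounded: "ess_bounded (rep_linf (u :: 'a linf))"
  using rep_linf_rel[of u] by (simp add: linf_rel_def)

lemma linf_eqI: "AE x in lebesgue. rep_linf u x = rep_linf v x \<Longrightarrow> u = (v :: 'a linf)"
  using Quotient_rel_rep[OF Quotient_linf, of u v] rep_linf_bounded[of u] rep_linf_bounded[of v]
  by (simp add: linf_rel_def)

lemma rep_abs_linf:
  "ess_bounded f \<Longrightarrow> AE x in lebesgue. rep_linf (abs_linf f :: 'a linf) x = f x"
  using Quotient_rep_abs[OF Quotient_linf, of f] by (simp add: linf_rel_def)

lemma rep_linf_zero: "AE x in lebesgue. rep_linf (0 :: 'a linf) x = 0"
  unfolding zero_linf_def using rep_abs_linf[OF ess_bounded_zero] by simp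

lemma rep_linf_add:
  "AE x in lebesgue. rep_linf (u + v :: 'a linf) x = rep_linf u x + rep_linf v x"
  unfolding plus_linf_def
  using rep_abs_linf[OF ess_bounded_add[OF rep_linf_bounded[of u] rep_linf_bounded[of v]]]
  by simp

lemma rep_linf_scaleR:
  "AE x in lebesgue. rep_linf (c *\<^sub>R u :: 'a linf) x = c *\<^sub>R rep_linf u x"
  unfolding scaleR_linf_def
  using rep_abs_linf[OF ess_bounded_scaleR[OF rep_linf_bounded[of u], of c]]
  by simp

lemma rep_linf_uminus: "AE x in lebesgue. rep_linf (- u :: 'a linf) x = - rep_linf u x"
  unfolding uminus_linf_def using rep_linf_scaleR[of "- 1" u] by simp

lemma rep_linf_diff:
  "AE x in lebesgue. rep_linf (u - v :: 'a linf) x = rep_linf u x - rep_linf v x"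
  unfolding minus_linf_def using rep_linf_add[of u "- v"] rep_linf_uminus[of v]
  by eventually_elim simp

lemma ess_norm_nonneg: "ess_bounded (f :: 'a \<Rightarrow> complex) \<Longrightarrow> 0 \<le> ess_norm f"
proof -
  have "emeasure lebesgue (space (lebesgue :: 'a measure)) \<noteq> 0"
    by simp
  then have "0 = esssup (lebesgue :: 'a measure) (\<lambda>x. 0 :: ereal)"
    by (rule esssup_const[symmetric])
  also have "\<dots> \<le> ess_norm f"
    unfolding ess_norm_def by (rule esssup_mono) simp_all
  finally show ?thesis .
qed

lemma norm_linf_alt: "ereal (norm (u :: 'a linf)) = ess_norm (rep_linf u)"
proof -
  have "0 \<le> ess_norm (rep_linf u)" "ess_norm (rep_linf u) < \<infinity>"
    using ess_norm_nonneg[OF rep_linf_bounded[of u]] rep_linf_bounded[of u]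
    by (auto simp: ess_bounded_def)
  then show ?thesis
    unfolding norm_linf_def by (cases "ess_norm (rep_linf u)") auto
qed

lemma norm_linf_AE: "AE x in lebesgue. cmod (rep_linf (u :: 'a linf) x) \<le> norm u"
proof -
  have "AE x in lebesgue. ereal (cmod (rep_linf u x)) \<le> ess_norm (rep_linf u)"
    unfolding ess_norm_def by (rule esssup_AE)
  then show ?thesis
    by (simp add: norm_linf_alt[symmetric])
qed

lemma norm_linf_le:
  assumes "AE x in lebesgue. cmod (rep_linf (u :: 'a linf) x) \<le> C"
  shows "norm u \<le> C"
proof -
  have [measurable]: "rep_linf u \<in> borel_measurable lebesgue"
    using rep_linf_bounded[of u] by (simp add: ess_bounded_def)
  have "AE x in lebesgue. ereal (cmod (rep_linf u x)) \<le> ereal C"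
    using assms by simp
  then have "ess_norm (rep_linf u) \<le> ereal C"
    unfolding ess_norm_def by (intro esssup_I) measurable
  then show ?thesis by (simp add: norm_linf_alt[symmetric])
qed

lemma norm_linf_nonneg: "0 \<le> norm (u :: 'a linf)"
  using ess_norm_nonneg[OF rep_linf_bounded[of u]] by (simp add: norm_linf_alt[symmetric])

instance
proof
  fix u v w :: "'a linf" and a b :: real and S :: "'a linf set"
  show "u + v + w = u + (v + w)"
    by (rule linf_eqI)
      (use rep_linf_add[of "u + v" w] rep_linf_add[of u v] rep_linf_add[of u "v + w"]
        rep_linf_add[of v w] in eventually_elim, simp)
  show "u + v = v + u"
    by (rule linf_eqI) (use rep_linf_add[of u v] rep_linf_add[of v u] in eventually_elim, simp)
  show "0 + u = u"
    by (rule linf_eqI) (use rep_linf_add[of 0 u] rep_linf_zero in eventually_elim, simp)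
  show "- u + u = 0"
    by (rule linf_eqI)
      (use rep_linf_add[of "- u" u] rep_linf_uminus[of u] rep_linf_zero in eventually_elim, simp)
  show "u - v = u + - v" by (rule minus_linf_def)
  show "a *\<^sub>R (u + v) = a *\<^sub>R u + a *\<^sub>R v"
    by (rule linf_eqI)
      (use rep_linf_add[of "a *\<^sub>R u" "a *\<^sub>R v"] rep_linf_add[of u v] rep_linf_scaleR[of a u]
        rep_linf_scaleR[of a v] rep_linf_scaleR[of a "u + v"]
        in eventually_elim, simp add: algebra_simps)
  show "(a + b) *\<^sub>R u = a *\<^sub>R u + b *\<^sub>R u"
    by (rule linf_eqI)
      (use rep_linf_add[of "a *\<^sub>R u" "b *\<^sub>R u"] rep_linf_scaleR[of a u]
        rep_linf_scaleR[of b u] rep_linf_scaleR[of "a + b" u]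
        in eventually_elim, simp add: algebra_simps)
  show "a *\<^sub>R b *\<^sub>R u = (a * b) *\<^sub>R u"
    by (rule linf_eqI)
      (use rep_linf_scaleR[of a "b *\<^sub>R u"] rep_linf_scaleR[of b u] rep_linf_scaleR[of "a * b" u]
        in eventually_elim, simp)
  show "1 *\<^sub>R u = u"
    by (rule linf_eqI) (use rep_linf_scaleR[of 1 u] in eventually_elim, simp)
  show "dist u v = norm (u - v)" by (rule dist_linf_def)
  show "sgn u = inverse (norm u) *\<^sub>R u" by (rule sgn_linf_def)
  show "(uniformity :: ('a linf \<times> 'a linf) filter) =
      (INF e\<in>{0 <..}. principal {(u, v). dist u v < e})"
    by (rule uniformity_linf_def)
  show "open S \<longleftrightarrow> (\<forall>u\<in>S. \<forall>\<^sub>F (v, w) in uniformity. v = u \<longrightarrow> w \<in> S)"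
    by (rule open_linf_def)
  show "norm u = 0 \<longleftrightarrow> u = 0"
  proof
    assume "norm u = 0"
    then show "u = 0"
      by (intro linf_eqI) (use norm_linf_AE[of u] rep_linf_zero in eventually_elim, simp)
  next
    assume u: "u = 0"
    have "AE x in lebesgue. cmod (rep_linf u x) \<le> 0"
      unfolding u using rep_linf_zero by eventually_elim simp
    then have "norm u \<le> 0" by (rule norm_linf_le)
    then show "norm u = 0" using norm_linf_nonneg[of u] by simp
  qed
  show "norm (u + v) \<le> norm u + norm v"
    by (rule norm_linf_le)
      (use norm_linf_AE[of u] norm_linf_AE[of v] rep_linf_add[of u v]
        in eventually_elim, simp add: norm_triangle_mono)
  show "norm (a *\<^sub>R u) = \<bar>a\<bar> * norm u"
  proof -
    have le: "norm (c *\<^sub>R w) \<le> \<bar>c\<bar> * norm w" for c and w :: "'a linf"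
      by (rule norm_linf_le)
        (use norm_linf_AE[of w] rep_linf_scaleR[of c w] in eventually_elim,
          simp add: mult_left_mono)
    show ?thesis
    proof (cases "a = 0")
      case True
      then show ?thesis using le[of a u] norm_linf_nonneg[of "a *\<^sub>R u"] by simp
    next
      case False
      have "u = inverse a *\<^sub>R a *\<^sub>R u"
        by (rule linf_eqI)
          (use rep_linf_scaleR[of "inverse a" "a *\<^sub>R u"] rep_linf_scaleR[of a u]
            in eventually_elim, simp add: False)
      then have "norm u \<le> \<bar>inverse a\<bar> * norm (a *\<^sub>R u)"
        using le[of "inverse a" "a *\<^sub>R u"] by simp
      then have "\<bar>a\<bar> * norm u \<le> norm (a *\<^sub>R u)"
        using False by (simp add: field_simps)
      then show ?thesis using le[of a u] by simp
    qed
  qed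
qed

end

instance linf :: (euclidean_space) banach
proof
  fix X :: "nat \<Rightarrow> 'a linf"
  assume X: "Cauchy X"
  have "AE x in lebesgue. \<forall>m n. cmod (rep_linf (X m) x - rep_linf (X n) x) \<le> norm (X m - X n)"
    unfolding AE_all_countable
  proof (intro allI)
    fix m n
    show "AE x in lebesgue. cmod (rep_linf (X m) x - rep_linf (X n) x) \<le> norm (X m - X n)"
      using norm_linf_AE[of "X m - X n"] rep_linf_diff[of "X m" "X n"] by eventually_elim simp
  qed
  then have key: "AE x in lebesgue. \<forall>m n.
      cmod (rep_linf (X m) x - rep_linf (X n) x) \<le> norm (X m - X n)" (is "AE x in _. ?good x") .
  define g where "g x = lim (\<lambda>n. rep_linf (X n) x)" for x
  have conv: "(\<lambda>n. rep_linf (X n) x) \<longlonglongrightarrow> g x" if "?good x" for x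
  proof -
    have "Cauchy (\<lambda>n. rep_linf (X n) x)"
    proof (rule metric_CauchyI)
      fix e :: real assume "e > 0"
      then obtain M where "\<forall>m\<ge>M. \<forall>n\<ge>M. dist (X m) (X n) < e"
        using X metric_CauchyD by blast
      then show "\<exists>M. \<forall>m\<ge>M. \<forall>n\<ge>M. dist (rep_linf (X m) x) (rep_linf (X n) x) < e"
        using that by (metis dist_norm le_less_trans)
    qed
    then show ?thesis
      unfolding g_def using Cauchy_convergent_iff convergent_LIMSEQ_iff by blast
  qed
  have [measurable]: "rep_linf (X n) \<in> borel_measurable lebesgue" for n
    using rep_linf_bounded[of "X n"] by (simp add: ess_bounded_def)
  have g_meas: "g \<in> borel_measurable lebesgue"
    unfolding g_def by measurable
  have close: "cmod (rep_linf (X n) x - g x) \<le> e"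
    if "?good x" "\<forall>m\<ge>M. \<forall>n\<ge>M. dist (X m) (X n) < e" "n \<ge> M" for x n M e
  proof (rule LIMSEQ_le_const2)
    show "(\<lambda>m. cmod (rep_linf (X n) x - rep_linf (X m) x)) \<longlonglongrightarrow> cmod (rep_linf (X n) x - g x)"
      by (intro tendsto_intros conv that)
    show "\<exists>N. \<forall>m\<ge>N. cmod (rep_linf (X n) x - rep_linf (X m) x) \<le> e"
      using that by (intro exI[of _ M]) (metis dist_norm less_le order_trans)
  qed
  have g_bdd: "ess_bounded g"
  proof -
    obtain M where M: "\<forall>m\<ge>M. \<forall>n\<ge>M. dist (X m) (X n) < 1"
      using X metric_CauchyD[of X 1] by auto
    have "AE x in lebesgue. cmod (g x) \<le> norm (X M) + 1"
      using key norm_linf_AE[of "X M"]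
    proof eventually_elim
      case (elim x)
      have "cmod (rep_linf (X M) x - g x) \<le> 1" by (rule close[OF elim(1) M]) simp
      then have "cmod (g x) \<le> cmod (rep_linf (X M) x) + 1"
        by (smt (verit) norm_triangle_ineq2 norm_minus_commute)
      with elim(2) show ?case by simp
    qed
    with g_meas show ?thesis
      unfolding ess_bounded_iff by (intro conjI exI[of _ "norm (X M) + 1"]) auto
  qed
  have "X \<longlonglongrightarrow> abs_linf g"
  proof (rule metric_LIMSEQ_I)
    fix r :: real assume "r > 0"
    then obtain M where M: "\<forall>m\<ge>M. \<forall>n\<ge>M. dist (X m) (X n) < r / 2"
      using X metric_CauchyD[of X "r / 2"] by auto
    have "dist (X n) (abs_linf g) < r" if "n \<ge> M" for n
    proof -
      have "norm (X n - abs_linf g) \<le> r / 2"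
      proof (rule norm_linf_le)
        show "AE x in lebesgue. cmod (rep_linf (X n - abs_linf g) x) \<le> r / 2"
          using key rep_linf_diff[of "X n" "abs_linf g"] rep_abs_linf[OF g_bdd]
        proof eventually_elim
          case (elim x)
          then show ?case using close[OF elim(1) M that] by simp
        qed
      qed
      with \<open>r > 0\<close> show ?thesis by (simp add: dist_norm)
    qed
    then show "\<exists>M. \<forall>n\<ge>M. dist (X n) (abs_linf g) < r" by blast
  qed
  then show "convergent X" by (auto simp: convergent_def)
qed


section \<open>Hankel functions and the outgoing fundamental solution\<close>

text \<open>Real order and positive argument. The reciprocal Gamma function is entire, so the series is
  also the right one at negative integer orders, where some terms vanish.\<close>

definition bessel_J :: "real \<Rightarrow> real \<Rightarrow> real" where
  "bessel_J \<nu> x = (\<Sum>m. (- 1) ^ m * rGamma (real m + \<nu> + 1) / fact m * (x / 2) powr (2 * real m + \<nu>))"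

definition bessel_Y :: "real \<Rightarrow> real \<Rightarrow> real" where
  "bessel_Y \<nu> x =
     (let y = (\<lambda>\<mu>. (bessel_J \<mu> x * cos (\<mu> * pi) - bessel_J (- \<mu>) x) / sin (\<mu> * pi))
      in if \<nu> \<in> \<int> then Lim (at \<nu>) y else y \<nu>)"

definition hankel1 :: "real \<Rightarrow> real \<Rightarrow> complex" where
  "hankel1 \<nu> x = complex_of_real (bessel_J \<nu> x) + \<i> * complex_of_real (bessel_Y \<nu> x)"

text \<open>The value at \<open>x = 0\<close> is irrelevant: \<open>\<Phi>\<close> only ever occurs under the integral sign.\<close>

definition helmholtz_\<Phi> :: "real \<Rightarrow> real ^ 'n \<Rightarrow> complex" where
  "helmholtz_\<Phi> k x =
     \<i> / 4 * complex_of_real ((k / (2 * pi * norm x)) powr ((real CARD('n) - 2) / 2))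
           * hankel1 ((real CARD('n) - 2) / 2) (k * norm x)"

definition convolution :: "(real ^ 'n \<Rightarrow> complex) \<Rightarrow> (real ^ 'n \<Rightarrow> complex) \<Rightarrow> real ^ 'n \<Rightarrow> complex" where
  "convolution g h x = (LINT y|lebesgue. g (x - y) * h y)"

definition resolvent :: "real \<Rightarrow> (real ^ 'n \<Rightarrow> complex) \<Rightarrow> real ^ 'n \<Rightarrow> complex" where
  "resolvent k h = convolution (helmholtz_\<Phi> k) h"


section \<open>The nonlinear integral equation\<close>

definition japanese_bracket :: "real ^ 'n \<Rightarrow> real" where
  "japanese_bracket x = sqrt (1 + (norm x)\<^sup>2)"

definition substitution_op :: "(real ^ 'n \<Rightarrow> complex \<Rightarrow> complex) \<Rightarrow> (real ^ 'n \<Rightarrow> complex) \<Rightarrow> real ^ 'n \<Rightarrow> complex" where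
  "substitution_op f u x = f x (u x)"

text \<open>The equation \<open>u = R\<^sub>k (N\<^sub>f u) + \<phi>\<close> in \<open>L\<^sup>\<infinity>\<close>, that is, almost everywhere. It does not
  depend on the choice of the representatives of \<open>u\<close> and \<open>\<phi>\<close>.\<close>

definition is_solution ::
  "real \<Rightarrow> (real ^ 'n \<Rightarrow> complex \<Rightarrow> complex) \<Rightarrow> (real ^ 'n) linf \<Rightarrow> (real ^ 'n) linf \<Rightarrow> bool" where
  "is_solution k f \<phi> u \<longleftrightarrow>
     (AE x in lebesgue.
        rep_linf u x = resolvent k (substitution_op f (rep_linf u)) x + rep_linf \<phi> x)"

definition C1_map_on :: "'a::real_normed_vector set \<Rightarrow> ('a \<Rightarrow> 'b::real_normed_vector) \<Rightarrow> bool" where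
  "C1_map_on V F \<longleftrightarrow>
     (\<exists>F' :: 'a \<Rightarrow> 'a \<Rightarrow>\<^sub>L 'b.
        (\<forall>x\<in>V. (F has_derivative blinfun_apply (F' x)) (at x)) \<and> continuous_on V F')"

end

theory Submission
  imports Defs "HOL-Complex_Analysis.Cauchy_Integral_Formula"
begin

text \<open>
  The map \<open>F u = R\<^sub>k (N\<^sub>f u)\<close> is \<open>C\<^sup>1\<close> on \<open>L\<^sup>\<infinity>\<close> with \<open>F 0 = 0\<close> and \<open>F' 0 = 0\<close>, so \<open>u - F u\<close> is
  a \<open>C\<^sup>1\<close> diffeomorphism near zero. Choosing \<open>(N + 1) / 2 < \<beta> < \<alpha>\<close>, the operator \<open>R\<^sub>k\<close> is bounded
  from \<open>\<langle>x\<rangle> powr (-\<beta>) L\<^sup>\<infinity>\<close> to \<open>L\<^sup>\<infinity>\<close>, and the slack \<open>\<alpha> - \<beta>\<close> makes \<open>N\<^sub>f\<close> continuously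
  differentiable into this weighted space. Boundedness needs \<open>\<bar>\<Phi>\<^sub>k x\<bar> \<le> C \<bar>x\<bar> powr (2 - N)\<close> near zero and
  \<open>\<bar>\<Phi>\<^sub>k x\<bar> \<le> C \<bar>x\<bar> powr ((1 - N) / 2)\<close> at infinity. Both follow from energy estimates for the first-order
  system satisfied by \<open>(J \<mu>, J (\<mu> + 1))\<close> and \<open>(Y \<mu>, Y (\<mu> + 1))\<close>, with constants depending continuously on
  \<open>\<mu>\<close>; integer orders are reached as limits.
\<close>

section \<open>Bessel functions\<close>

text \<open>The threshold \<open>(N + 1) / 2\<close> is where the decay \<open>(N - 1) / 2\<close>
  of the kernel and the exponent of the weight add up to \<open>N\<close>, the borderline of
  integrability at infinity. The obstacle is the size of the Hankel function. Its first part is a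
  power series whose alternating signs hide the decay at infinity, and for even \<open>N\<close> the
  order \<open>(N - 2) / 2\<close> is an integer, where the second part has no formula other than a
  limit in the order. Energies avoid asymptotic expansions: they carry the values at one fixed
  radius \<open>r0\<close> inwards to zero and outwards to infinity, and these values need only be
  finite. On the nonlinear side, a weight with the exponent \<open>\<alpha>\<close> itself would not
  do: \<open>\<langle>x\<rangle> powr \<alpha> * f' x u\<close> is bounded for bounded
  \<open>u\<close>, but need not be equicontinuous in \<open>u\<close> as \<open>x\<close> goes to
  infinity.\<close>

lemma norm_pochhammer_ge_1:
  fixes z :: complex
  assumes "Re z \<ge> 1"
  shows "norm (pochhammer z n) \<ge> 1"
proof (induction n)
  case (Suc n)
  have "1 \<le> Re (z + of_nat n)" using assms by simp
  also have "\<dots> \<le> norm (z + of_nat n)" by (rule complex_Re_le_cmod)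
  finally have "1 * 1 \<le> norm (pochhammer z n) * norm (z + of_nat n)"
    using Suc by (intro mult_mono) auto
  then show ?case by (simp add: pochhammer_Suc norm_mult)
qed simp

text \<open>This makes the Bessel series dominated by an exponential series, uniformly for orders in
  a disc. Once the argument has real part at least 1, \<open>pochhammer_rGamma\<close> shows that
  integer shifts do not increase \<open>norm (rGamma z)\<close>; the finitely many smaller shifts
  are bounded by compactness.\<close>

lemma rGamma_shifts_bounded:
  fixes R :: real
  obtains K where "K > 0"
    "\<And>(m::nat) \<mu>::complex. norm \<mu> \<le> R \<Longrightarrow> norm (rGamma (of_nat m + \<mu> + 1)) \<le> K"
proof -
  define m0 where "m0 = nat \<lceil>R\<rceil>"
  have m0: "R \<le> real m0" unfolding m0_def by linarith
  have "\<exists>K. \<forall>\<mu>::complex. norm \<mu> \<le> R \<longrightarrow> norm (rGamma (of_nat m + \<mu> + 1)) \<le> K" for m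
  proof -
    have "compact ((\<lambda>\<mu>::complex. rGamma (of_nat m + \<mu> + 1)) ` cball 0 R)"
      by (intro compact_continuous_image continuous_on_compose2[OF continuous_on_rGamma[of UNIV]] continuous_intros) auto
    then obtain K where "\<forall>x\<in>(\<lambda>\<mu>::complex. rGamma (of_nat m + \<mu> + 1)) ` cball 0 R. norm x \<le> K"
      using compact_imp_bounded bounded_iff by metis
    then show ?thesis by (intro exI[of _ K]) auto
  qed
  then obtain B where B: "\<And>m \<mu>. norm \<mu> \<le> R \<Longrightarrow> norm (rGamma (of_nat m + \<mu> + 1 :: complex)) \<le> B m"
    by metis
  define K where "K = 1 + (\<Sum>m\<le>m0. \<bar>B m\<bar>)"
  have small: "norm (rGamma (of_nat m + \<mu> + 1)) \<le> K" if "norm \<mu> \<le> R" "m \<le> m0" for m and \<mu> :: complex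
  proof -
    have "\<bar>B m\<bar> \<le> (\<Sum>m\<le>m0. \<bar>B m\<bar>)"
      using that by (intro member_le_sum) auto
    with B[OF that(1), of m] show ?thesis by (simp add: K_def)
  qed
  have "norm (rGamma (of_nat m + \<mu> + 1)) \<le> K" if "norm \<mu> \<le> R" for m and \<mu> :: complex
  proof (cases "m \<le> m0")
    case False
    define z where "z = of_nat m0 + \<mu> + 1"
    have "- R \<le> Re \<mu>" using that abs_Re_le_cmod[of \<mu>] by linarith
    then have "Re z \<ge> 1" using m0 by (simp add: z_def)
    have "rGamma z = pochhammer z (m - m0) * rGamma (z + of_nat (m - m0))"
      by (rule pochhammer_rGamma)
    also have "z + of_nat (m - m0) = of_nat m + \<mu> + 1"
      using False by (simp add: z_def of_nat_diff)
    finally have eq: "norm (rGamma z) = norm (pochhammer z (m - m0)) * norm (rGamma (of_nat m + \<mu> + 1))"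
      by (simp add: norm_mult)
    have "1 * norm (rGamma (of_nat m + \<mu> + 1)) \<le> norm (rGamma z)"
      unfolding eq by (intro mult_right_mono norm_pochhammer_ge_1 \<open>Re z \<ge> 1\<close>) auto
    also have "norm (rGamma z) \<le> K"
      unfolding z_def by (rule small[OF that]) simp
    finally show ?thesis by simp
  qed (use small that in auto)
  moreover have "K > 0" by (simp add: K_def sum_nonneg add_pos_nonneg)
  ultimately show ?thesis by (rule that[rotated])
qed

section \<open>The power series of the first kind and its recurrences in the order\<close>

definition bessel_coeff :: "real \<Rightarrow> nat \<Rightarrow> real" where
  "bessel_coeff \<mu> m = (- 1) ^ m * rGamma (real m + \<mu> + 1) / fact m"

text \<open>This is \<open>bessel_J \<mu> x\<close> without its factor
  \<open>(x / 2) powr \<mu>\<close>, in the variable \<open>s = (x / 2)\<^sup>2\<close>. What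
  remains is a power series converging everywhere, so it can be differentiated termwise.\<close>

definition bessel_series :: "real \<Rightarrow> real \<Rightarrow> real" where
  "bessel_series \<mu> s = (\<Sum>m. bessel_coeff \<mu> m * s ^ m)"

lemma summable_bessel_series: "summable (\<lambda>m. bessel_coeff \<mu> m * s ^ m)"
proof -
  obtain K where K: "K > 0"
    "\<And>m z. cmod z \<le> \<bar>\<mu>\<bar> \<Longrightarrow> cmod (rGamma (of_nat m + z + 1)) \<le> K"
    by (rule rGamma_shifts_bounded[of "\<bar>\<mu>\<bar>"]) blast
  have *: "\<bar>rGamma (real m + \<mu> + 1)\<bar> \<le> K" for m
    using K(2)[of "of_real \<mu>" m] rGamma_complex_of_real[of "real m + \<mu> + 1"] by simp
  have "summable (\<lambda>m. K * (inverse (fact m) * \<bar>s\<bar> ^ m))"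
    by (intro summable_mult summable_exp)
  then show ?thesis
  proof (rule summable_comparison_test')
    fix m :: nat
    show "norm (bessel_coeff \<mu> m * s ^ m) \<le> K * (inverse (fact m) * \<bar>s\<bar> ^ m)"
      using mult_right_mono[OF *[of m], of "\<bar>s\<bar> ^ m / fact m"]
      by (simp add: bessel_coeff_def abs_mult power_abs field_simps)
  qed
qed

lemma bessel_coeff_Suc: "real (Suc m) * bessel_coeff \<mu> (Suc m) = - bessel_coeff (\<mu> + 1) m"
proof -
  have "real (Suc m) + \<mu> + 1 = real m + (\<mu> + 1) + 1" by simp
  then show ?thesis unfolding bessel_coeff_def by (simp only:) (simp del: of_nat_Suc)
qed

text \<open>The functional equation \<open>z * rGamma (z + 1) = rGamma z\<close> also holds at the
  poles of Gamma, so the recurrences built on it need no exception at integer orders.\<close>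

lemma bessel_coeff_pred: "bessel_coeff (\<mu> - 1) m = (real m + \<mu>) * bessel_coeff \<mu> m"
  using rGamma_plus1[of "real m + \<mu>"] by (simp add: bessel_coeff_def)

lemma DERIV_bessel_series:
  "(bessel_series \<mu> has_real_derivative - bessel_series (\<mu> + 1) s) (at s)"
proof -
  have "((\<lambda>s. \<Sum>m. bessel_coeff \<mu> m * s ^ m) has_field_derivative
          (\<Sum>m. diffs (bessel_coeff \<mu>) m * s ^ m)) (at s)"
    by (rule termdiffs_strong_converges_everywhere) (rule summable_bessel_series)
  moreover have "(\<Sum>m. diffs (bessel_coeff \<mu>) m * s ^ m) = - bessel_series (\<mu> + 1) s"
    unfolding bessel_series_def diffs_def bessel_coeff_Suc
    using summable_bessel_series by (simp add: suminf_minus)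
  ultimately show ?thesis by (simp add: bessel_series_def[abs_def])
qed

lemma bessel_series_rec:
  "bessel_series (\<mu> - 1) s = \<mu> * bessel_series \<mu> s - s * bessel_series (\<mu> + 1) s"
proof -
  have 1: "(\<lambda>m. \<mu> * (bessel_coeff \<mu> m * s ^ m)) sums (\<mu> * bessel_series \<mu> s)"
    unfolding bessel_series_def by (intro sums_mult summable_sums summable_bessel_series)
  have "(\<lambda>m. s * (- bessel_coeff (\<mu> + 1) m * s ^ m)) sums (s * - bessel_series (\<mu> + 1) s)"
    unfolding bessel_series_def mult_minus_left
    by (intro sums_mult sums_minus summable_sums summable_bessel_series)
  also have "(\<lambda>m. s * (- bessel_coeff (\<mu> + 1) m * s ^ m)) =
      (\<lambda>m. real (Suc m) * bessel_coeff \<mu> (Suc m) * s ^ Suc m)"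
    unfolding bessel_coeff_Suc by (simp add: fun_eq_iff)
  \<comment> \<open>Shifting the index back costs nothing, because the term at \<open>m = 0\<close>
    carries the factor 0.\<close>
  finally have "(\<lambda>m. real m * bessel_coeff \<mu> m * s ^ m) sums (s * - bessel_series (\<mu> + 1) s)"
    by (subst (asm) sums_Suc_iff) simp
  from sums_add[OF 1 this] have "(\<lambda>m. bessel_coeff (\<mu> - 1) m * s ^ m) sums
      (\<mu> * bessel_series \<mu> s - s * bessel_series (\<mu> + 1) s)"
    unfolding bessel_coeff_pred by (simp add: algebra_simps)
  then show ?thesis by (simp add: bessel_series_def sums_iff)
qed

lemma bessel_J_eq:
  assumes "x > 0"
  shows "bessel_J \<mu> x = (x / 2) powr \<mu> * bessel_series \<mu> ((x / 2)\<^sup>2)"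
proof -
  have "(x / 2) powr (2 * real m + \<mu>) = (x / 2) powr \<mu> * ((x / 2)\<^sup>2) ^ m" for m
  proof -
    have "(x / 2) powr (2 * real m) = ((x / 2)\<^sup>2) ^ m"
      using assms powr_realpow[of "x / 2" "2 * m"] by (simp add: power_mult)
    then show ?thesis by (simp add: powr_add)
  qed
  then have "bessel_J \<mu> x = (\<Sum>m. (x / 2) powr \<mu> * (bessel_coeff \<mu> m * ((x / 2)\<^sup>2) ^ m))"
    unfolding bessel_J_def bessel_coeff_def by (intro suminf_cong) (simp add: mult_ac)
  also have "\<dots> = (x / 2) powr \<mu> * bessel_series \<mu> ((x / 2)\<^sup>2)"
    unfolding bessel_series_def by (rule suminf_mult[OF summable_bessel_series])
  finally show ?thesis .
qed

lemma bessel_J_rec: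
  assumes "x > 0"
  shows "bessel_J (\<mu> - 1) x = 2 * \<mu> / x * bessel_J \<mu> x - bessel_J (\<mu> + 1) x"
proof -
  have p: "(x / 2) powr \<mu> = (x / 2) powr (\<mu> - 1) * (x / 2)"
    "(x / 2) powr (\<mu> + 1) = (x / 2) powr (\<mu> - 1) * (x / 2)\<^sup>2"
    using assms by (simp_all add: powr_diff powr_add power2_eq_square)
  show ?thesis
    unfolding bessel_J_eq[OF assms] bessel_series_rec p using assms by (simp add: field_simps power2_eq_square)
qed

lemma DERIV_bessel_J:
  assumes x: "x > 0"
  shows "(bessel_J \<mu> has_real_derivative \<mu> / x * bessel_J \<mu> x - bessel_J (\<mu> + 1) x) (at x)"
proof -
  have "((\<lambda>x. (x / 2) powr \<mu> * bessel_series \<mu> ((x / 2)\<^sup>2)) has_real_derivative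
      (\<mu> * (x / 2) powr (\<mu> - 1) * (1 / 2)) * bessel_series \<mu> ((x / 2)\<^sup>2) +
      (x / 2) powr \<mu> * (- bessel_series (\<mu> + 1) ((x / 2)\<^sup>2) * (x / 2))) (at x)"
    using x by (auto intro!: derivative_eq_intros DERIV_chain2[OF DERIV_bessel_series]
        simp: powr_diff field_simps power2_eq_square)
  also have "?this \<longleftrightarrow> ?thesis"
  proof (intro DERIV_cong_ev refl)
    show "\<forall>\<^sub>F x in nhds x. (x / 2) powr \<mu> * bessel_series \<mu> ((x / 2)\<^sup>2) = bessel_J \<mu> x"
      using eventually_nhds_in_open[of "{0<..}" x] x
      by (auto elim!: eventually_mono simp: bessel_J_eq)
    show "(\<mu> * (x / 2) powr (\<mu> - 1) * (1 / 2)) * bessel_series \<mu> ((x / 2)\<^sup>2) +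
      (x / 2) powr \<mu> * (- bessel_series (\<mu> + 1) ((x / 2)\<^sup>2) * (x / 2)) =
      \<mu> / x * bessel_J \<mu> x - bessel_J (\<mu> + 1) x"
      unfolding bessel_J_eq[OF x] using x by (simp add: powr_diff powr_add field_simps)
  qed
  finally show ?thesis .
qed

text \<open>Because of this identity the numerator of the quotient defining the second kind vanishes
  at integer orders. Both sides obey the same three-term recurrence in the order, so the induction
  carries two consecutive orders.\<close>

lemma bessel_J_minus_nat:
  assumes x: "x > 0"
  shows "bessel_J (- real n) x = (- 1) ^ n * bessel_J (real n) x"
proof -
  have "bessel_J (- real n) x = (- 1) ^ n * bessel_J (real n) x \<and>
     bessel_J (- real (Suc n)) x = (- 1) ^ Suc n * bessel_J (real (Suc n)) x"
  proof (induction n)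
    case 0
    \<comment> \<open>At order 0 the factor \<open>2 * \<mu> / x\<close> vanishes, which leaves
      \<open>bessel_J (- 1) x = - bessel_J 1 x\<close>.\<close>
    show ?case using bessel_J_rec[OF x, of 0] by simp
  next
    case (Suc n)
    have "bessel_J (- real (Suc n) - 1) x = (- 1) ^ Suc (Suc n) * bessel_J (real (Suc n) + 1) x"
    proof -
      have a: "bessel_J (- real (Suc n) - 1) x =
          2 * (- real (Suc n)) / x * bessel_J (- real (Suc n)) x - bessel_J (- real n) x"
        using bessel_J_rec[OF x, of "- real (Suc n)"] by simp
      have b: "bessel_J (real n) x = 2 * real (Suc n) / x * bessel_J (real (Suc n)) x - bessel_J (real (Suc n) + 1) x"
        using bessel_J_rec[OF x, of "real (Suc n)"] by simp
      have c: "bessel_J (- real (Suc n)) x = (- 1) ^ Suc n * bessel_J (real (Suc n)) x"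
        "bessel_J (- real n) x = (- 1) ^ n * bessel_J (real n) x"
        using Suc by blast+
      show ?thesis unfolding a c b by (simp add: algebra_simps del: of_nat_Suc)
    qed
    with Suc show ?case by (simp add: algebra_simps)
  qed
  then show ?thesis by blast
qed

text \<open>The series converges locally uniformly in a complex order, so it is entire there.\<close>

lemma bessel_J_order_differentiable:
  assumes x: "x > 0"
  obtains D where "((\<lambda>\<mu>. bessel_J \<mu> x) has_real_derivative D) (at \<mu>0)"
proof -
  define s where "s = (x / 2)\<^sup>2"
  define a where "a m \<mu> = (- 1) ^ m * rGamma (of_nat m + \<mu> + 1) / fact m * of_real s ^ m" for m and \<mu> :: complex
  define \<Psi> where "\<Psi> \<mu> = (\<Sum>m. a m \<mu>)" for \<mu>
  have "\<Psi> holomorphic_on UNIV"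
  proof (rule holomorphic_uniform_sequence)
    show "(\<lambda>\<mu>. \<Sum>m<n. a m \<mu>) holomorphic_on UNIV" for n
      unfolding a_def by (intro holomorphic_intros) auto
    fix z :: complex
    obtain K where K: "K > 0"
      "\<And>m \<mu>. cmod \<mu> \<le> cmod z + 1 \<Longrightarrow> cmod (rGamma (of_nat m + \<mu> + 1)) \<le> K"
      by (rule rGamma_shifts_bounded[of "cmod z + 1"]) blast
    have "uniform_limit (cball z 1) (\<lambda>n \<mu>. \<Sum>m<n. a m \<mu>) \<Psi> sequentially"
      unfolding \<Psi>_def
    proof (rule Weierstrass_m_test)
      show "summable (\<lambda>m. K * (inverse (fact m) * \<bar>s\<bar> ^ m))"
        by (intro summable_mult summable_exp)
      fix m \<mu> assume "\<mu> \<in> cball z 1"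
      then have "cmod \<mu> \<le> cmod z + 1"
        using norm_triangle_ineq2[of \<mu> z] by (simp add: dist_norm norm_minus_commute)
      from mult_right_mono[OF K(2)[OF this, of m], of "\<bar>s\<bar> ^ m / fact m"]
      show "norm (a m \<mu>) \<le> K * (inverse (fact m) * \<bar>s\<bar> ^ m)"
        by (simp add: a_def norm_mult norm_divide norm_power field_simps)
    qed
    then show "\<exists>d>0. cball z d \<subseteq> UNIV \<and>
        uniform_limit (cball z d) (\<lambda>n \<mu>. \<Sum>m<n. a m \<mu>) \<Psi> sequentially"
      by (intro exI[of _ 1]) auto
  qed auto
  then have "(\<Psi> has_field_derivative deriv \<Psi> (of_real \<mu>0)) (at (of_real \<mu>0))"
    by (rule holomorphic_derivI) auto
  \<comment> \<open>The real part of the complex derivative is the derivative of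
    \<open>Re \<Psi>\<close> along the real axis, and \<open>\<Psi>\<close> is real there.\<close>
  then have Re_deriv: "((\<lambda>\<mu>. Re (\<Psi> (of_real \<mu>))) has_real_derivative Re (deriv \<Psi> (of_real \<mu>0))) (at \<mu>0)"
    by (intro has_real_derivative_iff_has_vector_derivative[THEN iffD2]
        bounded_linear.has_vector_derivative[OF bounded_linear_Re] has_vector_derivative_real_field)
  have \<Psi>_eq: "\<Psi> (of_real \<mu>) = of_real (bessel_series \<mu> s)" for \<mu>
  proof -
    have a_eq: "a m (of_real \<mu>) = of_real (bessel_coeff \<mu> m * s ^ m)" for m
      using rGamma_complex_of_real[of "real m + \<mu> + 1"] by (simp add: a_def bessel_coeff_def)
    show ?thesis
      unfolding \<Psi>_def bessel_series_def a_eq by (rule suminf_of_real[OF summable_bessel_series, symmetric])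
  qed
  define D where "D = Re (deriv \<Psi> (of_real \<mu>0))"
  have "((\<lambda>\<mu>. bessel_series \<mu> s) has_real_derivative D) (at \<mu>0)"
    using Re_deriv unfolding \<Psi>_eq Re_complex_of_real D_def .
  moreover have "((\<lambda>\<mu>. (x / 2) powr \<mu>) has_real_derivative ln (x / 2) * (x / 2) powr \<mu>0) (at \<mu>0)"
    using x by (auto intro!: derivative_eq_intros)
  ultimately have "((\<lambda>\<mu>. (x / 2) powr \<mu> * bessel_series \<mu> s) has_real_derivative
      ln (x / 2) * (x / 2) powr \<mu>0 * bessel_series \<mu>0 s + D * (x / 2) powr \<mu>0) (at \<mu>0)"
    by (rule DERIV_mult[rotated])
  then show ?thesis
    unfolding s_def bessel_J_eq[OF x, symmetric] by (rule that)
qed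

section \<open>The second kind, and the system shared by both kinds\<close>

definition bessel_Y_quot :: "real \<Rightarrow> real \<Rightarrow> real" where
  "bessel_Y_quot \<mu> x = (bessel_J \<mu> x * cos (\<mu> * pi) - bessel_J (- \<mu>) x) / sin (\<mu> * pi)"

text \<open>L'Hospital's rule: numerator and \<open>sin (\<mu> * pi)\<close> both vanish at
  \<open>n\<close>, both are differentiable there, and the sine has the nonzero derivative
  \<open>pi * (-1) ^ n\<close>. So the limit in the definition of \<open>bessel_Y\<close> exists,
  without which \<open>Lim\<close> would carry no information.\<close>

lemma bessel_Y_quot_tendsto:
  assumes x: "x > 0"
  shows "((\<lambda>\<mu>. bessel_Y_quot \<mu> x) \<longlongrightarrow> bessel_Y (real n) x) (at (real n))"
proof -
  define g where "g \<mu> = bessel_J \<mu> x * cos (\<mu> * pi) - bessel_J (- \<mu>) x" for \<mu>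
  obtain D1 where D1: "((\<lambda>\<mu>. bessel_J \<mu> x) has_real_derivative D1) (at (real n))"
    using bessel_J_order_differentiable[OF x] by blast
  obtain D2 where D2: "((\<lambda>\<mu>. bessel_J \<mu> x) has_real_derivative D2) (at (- real n))"
    using bessel_J_order_differentiable[OF x] by blast
  have "((\<lambda>\<mu>. bessel_J (- \<mu>) x) has_real_derivative D2 * (-1)) (at (real n))"
    by (rule DERIV_chain2[where g="uminus", OF D2]) (auto intro!: derivative_eq_intros)
  then have "\<exists>D. (g has_real_derivative D) (at (real n))"
    unfolding g_def using D1 by (auto intro!: exI derivative_eq_intros)
  then obtain D where "(g has_real_derivative D) (at (real n))" ..
  moreover have "g (real n) = 0"
    by (simp add: g_def bessel_J_minus_nat[OF x] mult.commute[of "real n"] cos_npi)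
  ultimately have g: "((\<lambda>\<mu>. g \<mu> / (\<mu> - real n)) \<longlongrightarrow> D) (at (real n))"
    by (simp add: has_field_derivative_iff)
  have "((\<lambda>\<mu>. sin (\<mu> * pi)) has_real_derivative pi * (-1) ^ n) (at (real n))"
    by (auto intro!: derivative_eq_intros simp: mult.commute[of "real n"] cos_npi)
  then have s: "((\<lambda>\<mu>. sin (\<mu> * pi) / (\<mu> - real n)) \<longlongrightarrow> pi * (-1) ^ n) (at (real n))"
    by (simp add: has_field_derivative_iff mult.commute[of "real n"] sin_npi)
  have "((\<lambda>\<mu>. (g \<mu> / (\<mu> - real n)) / (sin (\<mu> * pi) / (\<mu> - real n))) \<longlongrightarrow> D / (pi * (-1) ^ n)) (at (real n))"
    by (intro tendsto_divide g s) auto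
  then have lim: "((\<lambda>\<mu>. bessel_Y_quot \<mu> x) \<longlongrightarrow> D / (pi * (-1) ^ n)) (at (real n))"
    by (rule Lim_transform_eventually)
      (auto simp: bessel_Y_quot_def g_def eventually_at_filter)
  have "bessel_Y (real n) x = Lim (at (real n)) (\<lambda>\<mu>. bessel_Y_quot \<mu> x)"
    by (simp add: bessel_Y_def bessel_Y_quot_def)
  also have "\<dots> = D / (pi * (-1) ^ n)"
    by (intro tendsto_Lim lim) auto
  finally show ?thesis using lim by simp
qed

text \<open>Eliminating \<open>q\<close> gives Bessel's equation of order \<open>\<mu>\<close> for
  \<open>p\<close>. With the neighbouring order as second unknown the system has first order, and
  the energy estimates use nothing else about \<open>p\<close> and \<open>q\<close>.\<close>

definition bessel_system :: "real \<Rightarrow> (real \<Rightarrow> real) \<Rightarrow> (real \<Rightarrow> real) \<Rightarrow> bool" where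
  "bessel_system \<mu> p q \<longleftrightarrow> (\<forall>r>0. (p has_real_derivative \<mu> / r * p r - q r) (at r) \<and>
     (q has_real_derivative p r - (\<mu> + 1) / r * q r) (at r))"

lemma bessel_system_J: "bessel_system \<mu> (bessel_J \<mu>) (bessel_J (\<mu> + 1))"
proof -
  have "(bessel_J (\<mu> + 1) has_real_derivative bessel_J \<mu> r - (\<mu> + 1) / r * bessel_J (\<mu> + 1) r) (at r)"
    if "r > 0" for r
    by (rule DERIV_cong[OF DERIV_bessel_J[OF that]]) (use bessel_J_rec[OF that, of "\<mu> + 1"] in simp)
  then show ?thesis
    unfolding bessel_system_def using DERIV_bessel_J by blast
qed

text \<open>Raising the order by 1 flips the signs of both sine and cosine, so the two quotients
  share the denominator \<open>s\<close> and the system follows linearly from the one for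
  \<open>bessel_J\<close>. At integer \<open>\<mu>\<close> both quotients are divisions by zero,
  hence 0, and satisfy the system trivially; this is the case \<open>s = 0\<close> in
  \<open>alg1\<close> and \<open>alg2\<close>.\<close>

lemma bessel_system_Y_quot: "bessel_system \<mu> (bessel_Y_quot \<mu>) (bessel_Y_quot (\<mu> + 1))"
  unfolding bessel_system_def
proof (intro allI impI conjI)
  fix r :: real assume r: "r > 0"
 define c s where "c = cos (\<mu> * pi)" and "s = sin (\<mu> * pi)"
  have neg: "(a * - c - b) / - s = (a * c + b) / s" for a b c s :: real
  proof -
    have "a * - c - b = - (a * c + b)" by simp
    then show ?thesis by (simp only: minus_divide_divide)
  qed
  have "cos ((\<mu> + 1) * pi) = - cos (\<mu> * pi)" "sin ((\<mu> + 1) * pi) = - sin (\<mu> * pi)"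
    "- (\<mu> + 1) = - \<mu> - 1"
    by (simp_all add: distrib_right)
  then have Y1: "bessel_Y_quot (\<mu> + 1) = (\<lambda>x. (bessel_J (\<mu> + 1) x * c + bessel_J (- \<mu> - 1) x) / s)"
    unfolding bessel_Y_quot_def[abs_def] c_def s_def
    by (simp only: neg)
  have Y0: "bessel_Y_quot \<mu> = (\<lambda>x. (bessel_J \<mu> x * c - bessel_J (- \<mu>) x) / s)"
    unfolding bessel_Y_quot_def[abs_def] c_def s_def ..
  note D = DERIV_bessel_J[OF r]
  have alg1: "((m * a - b) * c - (d + m * e)) / s = m * ((a * c - e) / s) - (b * c + d) / s" for m a b d e
    by (cases "s = 0") (simp_all add: field_simps)
  have alg2: "((a - m * b) * c + (- (m * d) - e)) / s = (a * c - e) / s - m * ((b * c + d) / s)" for m a b d e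
    by (cases "s = 0") (simp_all add: field_simps)
  have d1: "(bessel_J (- \<mu>) has_real_derivative bessel_J (- \<mu> - 1) r + \<mu> / r * bessel_J (- \<mu>) r) (at r)"
    by (rule DERIV_cong[OF D]) (use bessel_J_rec[OF r, of "- \<mu>"] in simp)
  have d2: "(bessel_J (- \<mu> - 1) has_real_derivative - ((\<mu> + 1) / r * bessel_J (- \<mu> - 1) r) - bessel_J (- \<mu>) r) (at r)"
    by (rule DERIV_cong[OF D]) (simp add: diff_divide_distrib add_divide_distrib left_diff_distrib distrib_right)
  have d3: "(bessel_J (\<mu> + 1) has_real_derivative bessel_J \<mu> r - (\<mu> + 1) / r * bessel_J (\<mu> + 1) r) (at r)"
    using bessel_system_J[of \<mu>] r by (simp add: bessel_system_def)
  have "((\<lambda>x. (bessel_J \<mu> x * c - bessel_J (- \<mu>) x) / s) has_real_derivative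
      ((\<mu> / r * bessel_J \<mu> r - bessel_J (\<mu> + 1) r) * c -
        (bessel_J (- \<mu> - 1) r + \<mu> / r * bessel_J (- \<mu>) r)) / s) (at r)"
    by (intro DERIV_cdivide DERIV_diff DERIV_cmult_right D d1)
  then show "(bessel_Y_quot \<mu> has_real_derivative \<mu> / r * bessel_Y_quot \<mu> r - bessel_Y_quot (\<mu> + 1) r) (at r)"
    unfolding Y1 Y0 alg1 .
  have "((\<lambda>x. (bessel_J (\<mu> + 1) x * c + bessel_J (- \<mu> - 1) x) / s) has_real_derivative
      ((bessel_J \<mu> r - (\<mu> + 1) / r * bessel_J (\<mu> + 1) r) * c +
        (- ((\<mu> + 1) / r * bessel_J (- \<mu> - 1) r) - bessel_J (- \<mu>) r)) / s) (at r)"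
    by (intro DERIV_cdivide DERIV_add DERIV_cmult_right d2 d3)
  then show "(bessel_Y_quot (\<mu> + 1) has_real_derivative bessel_Y_quot \<mu> r - (\<mu> + 1) / r * bessel_Y_quot (\<mu> + 1) r) (at r)"
    unfolding Y1 Y0 alg2 .
qed

section \<open>Decay of the Hankel function\<close>

text \<open>The term \<open>c p q\<close> in the energy cancels the part of the derivative of \<open>r (p\<^sup>2 + q\<^sup>2)\<close> that is
  not integrable at infinity.\<close>

lemma bessel_system_bound_large:
  assumes sys: "bessel_system \<mu> p q" and \<mu>: "\<mu> > 0" and r0: "r0 \<ge> 2 * \<mu> + 1" and r: "r \<ge> r0"
  shows "(p r)\<^sup>2 \<le> 4 * exp 1 * r0 / r * ((p r0)\<^sup>2 + (q r0)\<^sup>2)"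
proof -
  \<comment> \<open>The system gives \<open>(2 * \<mu> + 1) * (p\<^sup>2 - q\<^sup>2)\<close> as
    derivative of \<open>r * (p\<^sup>2 + q\<^sup>2)\<close> and
    \<open>p\<^sup>2 - q\<^sup>2 - p * q / r\<close> as derivative of \<open>p * q\<close>. With
    this \<open>c\<close> the energy has the derivative \<open>c * p * q / r\<close>.\<close>
  define c where "c = 2 * \<mu> + 1"
  define E where "E r = r * ((p r)\<^sup>2 + (q r)\<^sup>2) - c * (p r * q r)" for r
  have c: "c > 0" "r0 \<ge> c" "r0 > 0" using \<mu> r0 by (auto simp: c_def)
  have pq: "\<bar>2 * (p s * q s)\<bar> \<le> (p s)\<^sup>2 + (q s)\<^sup>2" for s
    using sum_squares_bound[of "p s" "q s"] sum_squares_bound[of "- p s" "q s"] by (auto simp: abs_if)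
  \<comment> \<open>As \<open>s \<ge> r0 \<ge> c\<close>, the correction is at most half of the main
    term, so \<open>E s\<close> stays comparable to
    \<open>s * (p\<^sup>2 + q\<^sup>2)\<close>.\<close>
  have cpq: "\<bar>c * (p s * q s)\<bar> \<le> s / 2 * ((p s)\<^sup>2 + (q s)\<^sup>2)" if "s \<ge> r0" for s
  proof -
    have "\<bar>c * (p s * q s)\<bar> = c / 2 * \<bar>2 * (p s * q s)\<bar>" using c by (simp add: abs_mult)
    also have "\<dots> \<le> s / 2 * ((p s)\<^sup>2 + (q s)\<^sup>2)"
      using c that by (intro mult_mono pq) auto
    finally show ?thesis .
  qed
  \<comment> \<open>A Gronwall argument: the derivative of \<open>E\<close> is at most
    \<open>c / s\<^sup>2 * E s\<close>, whose coefficient is integrable at infinity and is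
    compensated by the factor \<open>exp (c / s)\<close>. At \<open>r0\<close> this factor is at
    most \<open>exp 1\<close>.\<close>
  have "E r * exp (c / r) \<le> E r0 * exp (c / r0)"
  proof (rule DERIV_nonpos_imp_nonincreasing[OF r])
    fix s assume "r0 \<le> s" "s \<le> r"
    then have s: "s > 0" "s \<ge> r0" using c by auto
    have dp: "(p has_real_derivative \<mu> / s * p s - q s) (at s)"
      and dq: "(q has_real_derivative p s - (\<mu> + 1) / s * q s) (at s)"
      using sys s by (auto simp: bessel_system_def)
    have "(E has_real_derivative c * (p s * q s) / s) (at s)"
      unfolding E_def
      by (rule derivative_eq_intros dp dq refl | simp)+
        (use s in \<open>simp add: c_def field_simps power2_eq_square\<close>)
    then have "((\<lambda>s. E s * exp (c / s)) has_real_derivative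
        exp (c / s) * (c * (p s * q s) / s - c / s\<^sup>2 * E s)) (at s)"
      using s by (auto intro!: derivative_eq_intros simp: field_simps power2_eq_square)
    moreover have "c * (p s * q s) / s \<le> c / s\<^sup>2 * E s"
    proof -
      have "c * (p s * q s) / s \<le> c / s\<^sup>2 * (s / 2 * ((p s)\<^sup>2 + (q s)\<^sup>2))"
      proof -
        have "c * (2 * (p s * q s)) \<le> c * ((p s)\<^sup>2 + (q s)\<^sup>2)"
          using c pq[of s] by (intro mult_left_mono) auto
        then have "c * (2 * (p s * q s)) / (2 * s) \<le> c * ((p s)\<^sup>2 + (q s)\<^sup>2) / (2 * s)"
          using s by (intro divide_right_mono) auto
        then show ?thesis using s by (simp add: power2_eq_square mult_ac)
      qed
      also have "\<dots> \<le> c / s\<^sup>2 * E s"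
        using cpq[OF s(2)] c s unfolding E_def by (intro mult_left_mono) (auto simp: field_simps)
      finally show ?thesis .
    qed
    ultimately show "\<exists>y. ((\<lambda>s. E s * exp (c / s)) has_real_derivative y) (at s) \<and> y \<le> 0"
      by (intro exI conjI) (assumption, simp add: mult_nonneg_nonpos)
  qed
  also have "\<dots> \<le> (2 * r0 * ((p r0)\<^sup>2 + (q r0)\<^sup>2)) * exp 1"
    using cpq[of r0] c by (intro mult_mono) (auto simp: E_def algebra_simps abs_le_iff)
  finally have "E r * exp (c / r) \<le> 2 * r0 * ((p r0)\<^sup>2 + (q r0)\<^sup>2) * exp 1" .
  moreover have "r / 2 * (p r)\<^sup>2 \<le> E r * exp (c / r)"
  proof -
    have "r / 2 * (p r)\<^sup>2 \<le> r / 2 * ((p r)\<^sup>2 + (q r)\<^sup>2)"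
      using r c by (intro mult_left_mono) auto
    also have "\<dots> \<le> E r" using cpq[OF r] by (auto simp: E_def algebra_simps abs_le_iff)
    finally have *: "r / 2 * (p r)\<^sup>2 \<le> E r" .
    have "0 \<le> r / 2 * (p r)\<^sup>2" using r c by simp
    with * have "0 \<le> E r" by linarith
    have "E r * 1 \<le> E r * exp (c / r)"
      using c r \<open>0 \<le> E r\<close> by (intro mult_left_mono) auto
    with * show ?thesis by simp
  qed
  ultimately have "r / 2 * (p r)\<^sup>2 \<le> 2 * r0 * ((p r0)\<^sup>2 + (q r0)\<^sup>2) * exp 1" by linarith
  then show ?thesis using r c by (simp add: field_simps)
qed

text \<open>Near zero Bessel's equation is a perturbation of Euler's equation with solutions
  \<open>r powr \<mu>\<close> and \<open>r powr - \<mu>\<close>. In terms of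
  \<open>A = \<mu> * p\<close> and \<open>B\<close>, which is \<open>s\<close> times the derivative
  of \<open>p\<close>, the weight \<open>s powr (2 * \<mu>)\<close> compensates the worse of the two
  and the factor \<open>exp (s\<^sup>2 / (2 * \<mu>))\<close> absorbs the perturbation. The
  derivative of \<open>G\<close> then is a positive combination of \<open>(A + B)\<^sup>2\<close>
  and \<open>(A - B)\<^sup>2\<close>, so \<open>G\<close> can be carried from \<open>r0\<close> down
  to \<open>r\<close>.\<close>

lemma bessel_system_bound_small:
  assumes sys: "bessel_system \<mu> p q" and \<mu>: "\<mu> > 0" and r: "0 < r" "r \<le> r0"
  shows "(\<mu> * p r)\<^sup>2 \<le> r powr (- 2 * \<mu>) *
    (r0 powr (2 * \<mu>) * ((\<mu> * p r0)\<^sup>2 + (\<mu> * p r0 - r0 * q r0)\<^sup>2) * exp (r0\<^sup>2 / (2 * \<mu>)))"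
proof -
  define A where "A s = \<mu> * p s" for s
  define B where "B s = \<mu> * p s - s * q s" for s
  define G where "G s = s powr (2 * \<mu>) * ((A s)\<^sup>2 + (B s)\<^sup>2) * exp (s\<^sup>2 / (2 * \<mu>))" for s
  have "G r \<le> G r0"
  proof (rule DERIV_nonneg_imp_nondecreasing[OF r(2)])
    fix s assume "r \<le> s" "s \<le> r0"
    then have s: "s > 0" using r by auto
    have dp: "(p has_real_derivative \<mu> / s * p s - q s) (at s)"
      and dq: "(q has_real_derivative p s - (\<mu> + 1) / s * q s) (at s)"
      using sys s by (auto simp: bessel_system_def)
    have dA: "(A has_real_derivative \<mu> / s * B s) (at s)"
      unfolding A_def B_def by (rule derivative_eq_intros dp refl | simp)+
        (use s in \<open>simp add: field_simps\<close>)
    have dB: "(B has_real_derivative \<mu> / s * A s - s / \<mu> * A s) (at s)"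
      unfolding A_def B_def by (rule derivative_eq_intros dp dq refl | simp)+
        (use s \<mu> in \<open>simp add: field_simps power2_eq_square\<close>)
    have dw: "((\<lambda>s. s powr (2 * \<mu>)) has_real_derivative 2 * \<mu> / s * s powr (2 * \<mu>)) (at s)"
      using s by (auto intro!: derivative_eq_intros simp: powr_diff)
    have de: "((\<lambda>s. exp (s\<^sup>2 / (2 * \<mu>))) has_real_derivative s / \<mu> * exp (s\<^sup>2 / (2 * \<mu>))) (at s)"
      using s \<mu> by (auto intro!: derivative_eq_intros)
    have dAB: "((\<lambda>s. (A s)\<^sup>2 + (B s)\<^sup>2) has_real_derivative
        2 * A s * (\<mu> / s * B s) + 2 * B s * (\<mu> / s * A s - s / \<mu> * A s)) (at s)"
      by (auto intro!: derivative_eq_intros dA dB)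
    have "(G has_real_derivative s powr (2 * \<mu>) * exp (s\<^sup>2 / (2 * \<mu>)) *
        (2 * \<mu> / s * (A s + B s)\<^sup>2 + s / \<mu> * (A s - B s)\<^sup>2)) (at s)"
      unfolding G_def
      by (rule DERIV_cong[OF DERIV_mult[OF DERIV_mult[OF dw dAB] de]])
        (simp add: algebra_simps power2_eq_square add_divide_distrib)
    moreover have "0 \<le> s powr (2 * \<mu>) * exp (s\<^sup>2 / (2 * \<mu>)) *
        (2 * \<mu> / s * (A s + B s)\<^sup>2 + s / \<mu> * (A s - B s)\<^sup>2)"
      using s \<mu> by (intro mult_nonneg_nonneg add_nonneg_nonneg) auto
    ultimately show "\<exists>y. (G has_real_derivative y) (at s) \<and> 0 \<le> y" by blast
  qed
  moreover have "r powr (2 * \<mu>) * (\<mu> * p r)\<^sup>2 \<le> G r"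
  proof -
    have "r powr (2 * \<mu>) * (\<mu> * p r)\<^sup>2 * 1 \<le> r powr (2 * \<mu>) * ((A r)\<^sup>2 + (B r)\<^sup>2) * exp (r\<^sup>2 / (2 * \<mu>))"
      using \<mu> by (intro mult_mono) (auto simp: A_def)
    then show ?thesis by (simp add: G_def)
  qed
  ultimately have "r powr (2 * \<mu>) * (\<mu> * p r)\<^sup>2 \<le> G r0" by linarith
  then have le: "r powr (- 2 * \<mu>) * (r powr (2 * \<mu>) * (\<mu> * p r)\<^sup>2) \<le> r powr (- 2 * \<mu>) * G r0"
    by (intro mult_left_mono) auto
  have eq: "r powr (- 2 * \<mu>) * (r powr (2 * \<mu>) * (\<mu> * p r)\<^sup>2) = (\<mu> * p r)\<^sup>2"
    using r by (simp add: powr_minus field_simps)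
  show ?thesis using le unfolding eq by (simp only: G_def A_def B_def)
qed

text \<open>The constants depend continuously on the order, so the bounds survive the limit that
  defines the Bessel functions of the second kind at integer orders.\<close>

lemma bessel_system_limit_bound:
  assumes \<nu>: "\<nu> > 0" and \<mu>: "\<mu> \<longlonglongrightarrow> \<nu>"
    and sys: "\<And>j. bessel_system (\<mu> j) (p j) (q j)"
    and p: "\<And>r. r > 0 \<Longrightarrow> (\<lambda>j. p j r) \<longlonglongrightarrow> P r"
    and q: "\<And>r. r > 0 \<Longrightarrow> (\<lambda>j. q j r) \<longlonglongrightarrow> Q r"
  shows "\<exists>C\<ge>0. (\<forall>r. 0 < r \<longrightarrow> r \<le> 2 * \<nu> + 2 \<longrightarrow> \<bar>P r\<bar> \<le> C * r powr (- \<nu>)) \<and>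
    (\<forall>r\<ge>2 * \<nu> + 2. \<bar>P r\<bar> \<le> C * r powr (- 1 / 2))"
proof -
  \<comment> \<open>The outer estimate needs \<open>r0 \<ge> 2 * \<mu> j + 1\<close>. Taking one
    more than \<open>2 * \<nu> + 1\<close> gives this as soon as
    \<open>\<mu> j < \<nu> + 1 / 2\<close>, with the same radius for all these
    \<open>j\<close>.\<close>
  define r0 where "r0 = 2 * \<nu> + 2"
  have r0: "r0 > 0" using \<nu> by (simp add: r0_def)
  note lims = p[OF r0] q[OF r0] \<mu>
  define M where "M = r0 powr (2 * \<nu>) * ((\<nu> * P r0)\<^sup>2 + (\<nu> * P r0 - r0 * Q r0)\<^sup>2) * exp (r0\<^sup>2 / (2 * \<nu>))"
  define L where "L = 4 * exp 1 * r0 * ((P r0)\<^sup>2 + (Q r0)\<^sup>2)"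
  have ev_pos: "\<forall>\<^sub>F j in sequentially. \<mu> j > 0"
    by (rule order_tendstoD(1)[OF \<mu> \<nu>])
  have ev_r0: "\<forall>\<^sub>F j in sequentially. \<mu> j < \<nu> + 1 / 2"
    by (rule order_tendstoD(2)[OF \<mu>]) simp
  have small: "(\<nu> * P r)\<^sup>2 \<le> r powr (- 2 * \<nu>) * M" if r: "0 < r" "r \<le> r0" for r
  proof (rule tendsto_le[OF sequentially_bot])
    show "(\<lambda>j. (\<mu> j * p j r)\<^sup>2) \<longlonglongrightarrow> (\<nu> * P r)\<^sup>2"
      by (intro tendsto_intros \<mu> p r)
    show "(\<lambda>j. r powr (- 2 * \<mu> j) * (r0 powr (2 * \<mu> j) * ((\<mu> j * p j r0)\<^sup>2 +
        (\<mu> j * p j r0 - r0 * q j r0)\<^sup>2) * exp (r0\<^sup>2 / (2 * \<mu> j)))) \<longlonglongrightarrow> r powr (- 2 * \<nu>) * M"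
      unfolding M_def using r r0 \<nu> by (intro tendsto_intros lims) auto
    show "\<forall>\<^sub>F j in sequentially. (\<mu> j * p j r)\<^sup>2 \<le> r powr (- 2 * \<mu> j) * (r0 powr (2 * \<mu> j) *
        ((\<mu> j * p j r0)\<^sup>2 + (\<mu> j * p j r0 - r0 * q j r0)\<^sup>2) * exp (r0\<^sup>2 / (2 * \<mu> j)))"
      using ev_pos by eventually_elim (rule bessel_system_bound_small[OF sys _ r])
  qed
  have large: "(P r)\<^sup>2 \<le> L / r" if r: "r \<ge> r0" for r
  proof (rule tendsto_le[OF sequentially_bot])
    show "(\<lambda>j. (p j r)\<^sup>2) \<longlonglongrightarrow> (P r)\<^sup>2"
      using r r0 by (intro tendsto_intros p) auto
    show "(\<lambda>j. 4 * exp 1 * r0 / r * ((p j r0)\<^sup>2 + (q j r0)\<^sup>2)) \<longlonglongrightarrow> L / r"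
    proof -
      have "(\<lambda>j. 4 * exp 1 * r0 / r * ((p j r0)\<^sup>2 + (q j r0)\<^sup>2)) \<longlonglongrightarrow>
          4 * exp 1 * r0 / r * ((P r0)\<^sup>2 + (Q r0)\<^sup>2)"
        by (intro tendsto_intros lims)
      then show ?thesis by (simp add: L_def)
    qed
    show "\<forall>\<^sub>F j in sequentially. (p j r)\<^sup>2 \<le> 4 * exp 1 * r0 / r * ((p j r0)\<^sup>2 + (q j r0)\<^sup>2)"
      using ev_pos ev_r0
      by eventually_elim (rule bessel_system_bound_large[OF sys _ _ r], auto simp: r0_def)
  qed
  have nonneg: "0 \<le> M" "0 \<le> L" using r0 by (simp_all add: M_def L_def)
  define C where "C = max (sqrt M / \<nu>) (sqrt L)"
  show ?thesis
  proof (intro exI[of _ C] conjI allI impI)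
    show "C \<ge> 0" using nonneg by (simp add: C_def le_max_iff_disj)
    fix r :: real
    show "\<bar>P r\<bar> \<le> C * r powr (- \<nu>)" if "0 < r" "r \<le> 2 * \<nu> + 2"
    proof -
      have "\<bar>\<nu> * P r\<bar> \<le> sqrt (r powr (- 2 * \<nu>) * M)"
        using real_sqrt_le_mono[OF small[of r]] that by (simp add: r0_def)
      also have "\<dots> = r powr (- \<nu>) * sqrt M"
        using that by (simp add: real_sqrt_mult powr_half_sqrt[symmetric] powr_powr)
      finally have "\<bar>P r\<bar> \<le> sqrt M / \<nu> * r powr (- \<nu>)"
        using \<nu> by (simp add: abs_mult field_simps)
      also have "\<dots> \<le> C * r powr (- \<nu>)" by (intro mult_right_mono) (auto simp: C_def)
      finally show ?thesis .
    qed
    show "\<bar>P r\<bar> \<le> C * r powr (- 1 / 2)" if "r \<ge> 2 * \<nu> + 2"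
    proof -
      have "r > 0" using that \<nu> by linarith
      then have root: "r powr (- 1 / 2) = 1 / sqrt r"
        using powr_minus_divide[of r "1 / 2"] by (simp add: powr_half_sqrt)
      have "\<bar>P r\<bar> \<le> sqrt (L / r)"
        using real_sqrt_le_mono[OF large[of r]] that by (simp add: r0_def)
      also have "\<dots> = sqrt L * r powr (- 1 / 2)"
        unfolding root by (simp add: real_sqrt_divide)
      also have "\<dots> \<le> C * r powr (- 1 / 2)" by (intro mult_right_mono) (auto simp: C_def)
      finally show ?thesis .
    qed
  qed
qed

text \<open>The system is known for the quotients only; this sequence transfers its consequences to
  \<open>bessel_Y\<close>. At an integer order the sequence has to avoid \<open>\<nu>\<close>
  itself, where the quotient is a division by zero. Of the neighbouring order only convergence
  matters, hence the unspecified \<open>Q\<close>.\<close>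

lemma bessel_Y_approx:
  assumes "\<nu> \<ge> 0"
  obtains \<mu> :: "nat \<Rightarrow> real" and Q where "\<mu> \<longlonglongrightarrow> \<nu>"
    "\<And>r. r > 0 \<Longrightarrow> (\<lambda>j. bessel_Y_quot (\<mu> j) r) \<longlonglongrightarrow> bessel_Y \<nu> r"
    "\<And>r. r > 0 \<Longrightarrow> (\<lambda>j. bessel_Y_quot (\<mu> j + 1) r) \<longlonglongrightarrow> Q r"
proof (cases "\<nu> \<in> \<int>")
  case False
  then have "bessel_Y \<nu> r = bessel_Y_quot \<nu> r" for r
    by (simp add: bessel_Y_def bessel_Y_quot_def)
  then show ?thesis
    by (intro that[of "\<lambda>_. \<nu>" "bessel_Y_quot (\<nu> + 1)"]) auto
next
  case True
  then obtain n where n: "\<nu> = real n"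
    using assms by (auto elim!: Ints_cases) (metis of_int_of_nat_eq of_int_0_le_iff zero_le_imp_eq_int)
  define \<mu> where "\<mu> j = real n + inverse (real (Suc j))" for j
  have "\<mu> \<longlonglongrightarrow> real n + 0"
    unfolding \<mu>_def by (intro tendsto_intros LIMSEQ_inverse_real_of_nat)
  then have lim: "\<mu> \<longlonglongrightarrow> real n" by simp
  have \<mu>: "filterlim \<mu> (at (real n)) sequentially"
    using lim by (auto simp: filterlim_at \<mu>_def simp del: of_nat_Suc)
  have "(\<lambda>j. \<mu> j + 1) \<longlonglongrightarrow> real (Suc n)"
    using tendsto_add[OF lim tendsto_const[of 1]] by (simp add: add.commute)
  then have \<mu>1: "filterlim (\<lambda>j. \<mu> j + 1) (at (real (Suc n))) sequentially"
    by (auto simp: filterlim_at \<mu>_def)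
  show ?thesis
  proof (rule that[of \<mu> "bessel_Y (real (Suc n))"])
    show "\<mu> \<longlonglongrightarrow> \<nu>" using lim by (simp add: n)
    show "(\<lambda>j. bessel_Y_quot (\<mu> j) r) \<longlonglongrightarrow> bessel_Y \<nu> r" if "r > 0" for r
      unfolding n by (rule filterlim_compose[OF bessel_Y_quot_tendsto[OF that] \<mu>])
    show "(\<lambda>j. bessel_Y_quot (\<mu> j + 1) r) \<longlonglongrightarrow> bessel_Y (real (Suc n)) r" if "r > 0" for r
      by (rule filterlim_compose[OF bessel_Y_quot_tendsto[OF that] \<mu>1])
  qed
qed

lemma hankel1_bound:
  assumes \<nu>: "\<nu> > 0"
  obtains C where "C \<ge> 0"
    "\<And>r. 0 < r \<Longrightarrow> r \<le> 2 * \<nu> + 2 \<Longrightarrow> cmod (hankel1 \<nu> r) \<le> C * r powr (- \<nu>)"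
    "\<And>r. r \<ge> 2 * \<nu> + 2 \<Longrightarrow> cmod (hankel1 \<nu> r) \<le> C * r powr (- 1 / 2)"
proof -
  obtain C1 where C1: "C1 \<ge> 0"
    "\<And>r. 0 < r \<Longrightarrow> r \<le> 2 * \<nu> + 2 \<Longrightarrow> \<bar>bessel_J \<nu> r\<bar> \<le> C1 * r powr (- \<nu>)"
    "\<And>r. r \<ge> 2 * \<nu> + 2 \<Longrightarrow> \<bar>bessel_J \<nu> r\<bar> \<le> C1 * r powr (- 1 / 2)"
    using bessel_system_limit_bound[OF \<nu> tendsto_const bessel_system_J tendsto_const tendsto_const] by blast
  obtain \<mu> Q where \<mu>: "\<mu> \<longlonglongrightarrow> \<nu>"
    "\<And>r. r > 0 \<Longrightarrow> (\<lambda>j. bessel_Y_quot (\<mu> j) r) \<longlonglongrightarrow> bessel_Y \<nu> r"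
    "\<And>r. r > 0 \<Longrightarrow> (\<lambda>j. bessel_Y_quot (\<mu> j + 1) r) \<longlonglongrightarrow> Q r"
    using bessel_Y_approx[of \<nu>] \<nu> by (metis less_imp_le)
  obtain C2 where C2: "C2 \<ge> 0"
    "\<And>r. 0 < r \<Longrightarrow> r \<le> 2 * \<nu> + 2 \<Longrightarrow> \<bar>bessel_Y \<nu> r\<bar> \<le> C2 * r powr (- \<nu>)"
    "\<And>r. r \<ge> 2 * \<nu> + 2 \<Longrightarrow> \<bar>bessel_Y \<nu> r\<bar> \<le> C2 * r powr (- 1 / 2)"
    using bessel_system_limit_bound[OF \<nu> \<mu>(1) bessel_system_Y_quot \<mu>(2) \<mu>(3)] by blast
  have *: "cmod (hankel1 \<nu> r) \<le> \<bar>bessel_J \<nu> r\<bar> + \<bar>bessel_Y \<nu> r\<bar>" for r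
    unfolding hankel1_def by (rule order_trans[OF norm_triangle_ineq]) (simp add: norm_mult)
  show ?thesis
  proof (rule that[of "C1 + C2"])
    fix r :: real
    show "cmod (hankel1 \<nu> r) \<le> (C1 + C2) * r powr (- \<nu>)" if "0 < r" "r \<le> 2 * \<nu> + 2"
      using *[of r] C1(2)[OF that] C2(2)[OF that] by (simp add: distrib_right)
    show "cmod (hankel1 \<nu> r) \<le> (C1 + C2) * r powr (- 1 / 2)" if "r \<ge> 2 * \<nu> + 2"
      using *[of r] C1(3)[OF that] C2(3)[OF that] by (simp add: distrib_right)
  qed (use C1 C2 in simp)
qed

text \<open>The quotients are continuous on the positive axis since they solve the system; at
  integer order the second kind is measurable as their pointwise limit.\<close>

lemma borel_measurable_hankel1:
  assumes "\<nu> \<ge> 0"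
  shows "(\<lambda>r. if r > 0 then hankel1 \<nu> r else 0) \<in> borel_measurable borel"
proof -
  have sys: "(\<lambda>r. if r > 0 then p r else 0) \<in> borel_measurable borel"
    if "bessel_system \<mu> p q" for \<mu> p q
  proof -
    have "continuous_on {0<..} p"
      using that by (intro continuous_at_imp_continuous_on)
        (auto simp: bessel_system_def intro: DERIV_isCont)
    then have "(\<lambda>r. if r \<in> {0<..} then p r else 0) \<in> borel_measurable borel"
      by (intro borel_measurable_continuous_on_if) auto
    then show ?thesis by simp
  qed
  obtain \<mu> Q where \<mu>: "\<mu> \<longlonglongrightarrow> \<nu>"
    "\<And>r. r > 0 \<Longrightarrow> (\<lambda>j. bessel_Y_quot (\<mu> j) r) \<longlonglongrightarrow> bessel_Y \<nu> r"
    "\<And>r. r > 0 \<Longrightarrow> (\<lambda>j. bessel_Y_quot (\<mu> j + 1) r) \<longlonglongrightarrow> Q r"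
    using bessel_Y_approx[OF assms] by metis
  have [measurable]: "(\<lambda>r. if r > 0 then bessel_Y \<nu> r else 0) \<in> borel_measurable borel"
  proof (rule borel_measurable_LIMSEQ_real)
    show "(\<lambda>r. if r > 0 then bessel_Y_quot (\<mu> j) r else 0) \<in> borel_measurable borel" for j
      by (rule sys[OF bessel_system_Y_quot])
    show "(\<lambda>j. if r > 0 then bessel_Y_quot (\<mu> j) r else 0) \<longlonglongrightarrow> (if r > 0 then bessel_Y \<nu> r else 0)" for r
      using \<mu>(2) by simp
  qed
  note [measurable] = sys[OF bessel_system_J[of \<nu>]]
  have "(\<lambda>r. if r > 0 then hankel1 \<nu> r else 0) =
    (\<lambda>r. complex_of_real (if r > 0 then bessel_J \<nu> r else 0) + \<i> * complex_of_real (if r > 0 then bessel_Y \<nu> r else 0))"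
    by (auto simp: hankel1_def)
  then show ?thesis by simp
qed

section \<open>The fundamental solution in weighted spaces\<close>

text \<open>This replaces polar coordinates for radial powers: the function is dominated by a sum of
  multiples of indicators of balls, and a ball of radius \<open>R j\<close> has volume proportional
  to \<open>R j ^ DIM('a)\<close>.\<close>

lemma nn_integral_ball_cover_finite:
  fixes g :: "'a::euclidean_space \<Rightarrow> ennreal" and c R :: "nat \<Rightarrow> real"
  assumes nonneg: "\<And>j. c j \<ge> 0" "\<And>j. R j \<ge> 0"
    and summable: "summable (\<lambda>j. c j * R j ^ DIM('a))"
    and cover: "\<And>z. g z \<noteq> 0 \<Longrightarrow> \<exists>j. norm z < R j \<and> g z \<le> ennreal (c j)"
  shows "(\<integral>\<^sup>+z. g z \<partial>lborel) < \<infinity>"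
proof -
  define \<omega> where "\<omega> = measure lborel (ball (0::'a) 1)"
  have le: "g z \<le> (\<Sum>j. ennreal (c j) * indicator (ball 0 (R j)) z)" for z
  proof (cases "g z = 0")
    case False
    then obtain j where j: "norm z < R j" "g z \<le> ennreal (c j)" using cover by blast
    then have "g z \<le> ennreal (c j) * indicator (ball 0 (R j)) z" by simp
    also have "\<dots> \<le> (\<Sum>j. ennreal (c j) * indicator (ball 0 (R j)) z)"
    proof -
      define f where "f i = ennreal (c i) * indicator (ball 0 (R i)) z" for i
      have "sum f {j} \<le> suminf f" by (intro sum_le_suminf) auto
      then have "f j \<le> (\<Sum>i. f i)" by simp
      then show ?thesis unfolding f_def .
    qed
    finally show ?thesis .
  qed simp
  have "(\<integral>\<^sup>+z. g z \<partial>lborel) \<le> (\<integral>\<^sup>+(z::'a). (\<Sum>j. ennreal (c j) * indicator (ball 0 (R j)) z) \<partial>lborel)"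
    by (intro nn_integral_mono le)
  also have "\<dots> = (\<Sum>j. \<integral>\<^sup>+(z::'a). ennreal (c j) * indicator (ball 0 (R j)) z \<partial>lborel)"
  proof (rule nn_integral_suminf)
    fix j
    have [measurable]: "ball (0::'a) (R j) \<in> sets borel" by (intro borel_open open_ball)
    show "(\<lambda>z::'a. ennreal (c j) * indicator (ball 0 (R j)) z) \<in> borel_measurable lborel" by measurable
  qed
  also have "\<dots> = (\<Sum>j. ennreal (c j * R j ^ DIM('a) * \<omega>))"
  proof (intro suminf_cong)
    fix j
    have "emeasure lborel (ball (0::'a) (R j)) = ennreal (R j ^ DIM('a) * \<omega>)"
      using emeasure_lborel_ball_finite[of "0::'a" "R j"] content_ball_conv_unit_ball[OF nonneg(2)[of j], of "0::'a"]
      by (subst emeasure_eq_ennreal_measure) (auto simp: \<omega>_def)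
    then show "(\<integral>\<^sup>+z. ennreal (c j) * indicator (ball (0::'a) (R j)) z \<partial>lborel) =
        ennreal (c j * R j ^ DIM('a) * \<omega>)"
      using nonneg by (simp add: nn_integral_cmult_indicator ennreal_mult[symmetric] \<omega>_def mult.assoc)
  qed
  also have "\<dots> = ennreal (\<Sum>j. c j * R j ^ DIM('a) * \<omega>)"
    by (rule suminf_ennreal2) (simp_all add: nonneg \<omega>_def summable_mult2 summable)
  also have "\<dots> < \<infinity>" by simp
  finally show ?thesis .
qed

lemma dyadic_annulus:
  fixes t \<rho> :: real
  assumes "t \<ge> \<rho>" "\<rho> > 0"
  obtains j :: nat where "\<rho> * 2 ^ j \<le> t" "t < \<rho> * 2 ^ Suc j"
proof -
  define j where "j = nat \<lfloor>log 2 (t / \<rho>)\<rfloor>"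
  have "log 2 (t / \<rho>) \<ge> 0" using assms by simp
  then have "real j \<le> log 2 (t / \<rho>)" "log 2 (t / \<rho>) < real (Suc j)"
    unfolding j_def by linarith+
  then have "2 powr real j \<le> t / \<rho>" "t / \<rho> < 2 powr real (Suc j)"
    using assms by (simp_all add: le_log_iff log_less_iff)
  then have "2 ^ j \<le> t / \<rho>" "t / \<rho> < 2 ^ Suc j"
    by (simp_all only: powr_realpow zero_less_numeral)
  then show ?thesis using assms by (intro that[of j]) (simp_all add: field_simps)
qed

text \<open>On a dyadic shell the power is bounded by its value at the inner radius. Together with
  the volume of the outer ball this gives a geometric series of ratio
  \<open>2 powr (DIM('a) - \<gamma>)\<close>.\<close>

lemma nn_integral_norm_powr_outside_ball:
  assumes \<gamma>: "\<gamma> > real DIM('a)" and \<rho>: "\<rho> > 0"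
  shows "(\<integral>\<^sup>+(z::'a::euclidean_space). (if norm z \<ge> \<rho> then ennreal (norm z powr - \<gamma>) else 0) \<partial>lborel) < \<infinity>"
proof (rule nn_integral_ball_cover_finite[where c = "\<lambda>j. (\<rho> * 2 ^ j) powr - \<gamma>" and R = "\<lambda>j. \<rho> * 2 ^ Suc j"])
  have "(\<rho> * 2 ^ j) powr - \<gamma> * (\<rho> * 2 ^ Suc j) ^ DIM('a) =
      (\<rho> powr - \<gamma> * (2 * \<rho>) ^ DIM('a)) * (2 powr (real DIM('a) - \<gamma>)) ^ j" for j
  proof -
    have "(2 powr (real DIM('a) - \<gamma>)) ^ j = 2 powr (real j * (real DIM('a) - \<gamma>))"
      by (simp add: powr_powr powr_realpow[symmetric] mult.commute)
    also have "\<dots> = (2 ^ j) powr - \<gamma> * (2 ^ j) ^ DIM('a)"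
      by (simp add: powr_realpow[symmetric] powr_powr powr_add[symmetric] algebra_simps)
    finally show ?thesis
      using \<rho> by (simp add: powr_mult power_mult_distrib)
  qed
  moreover have "2 powr (real DIM('a) - \<gamma>) < 1"
    using \<gamma> powr_less_mono[of "real DIM('a) - \<gamma>" 0 2] by simp
  ultimately show "summable (\<lambda>j. (\<rho> * 2 ^ j) powr - \<gamma> * (\<rho> * 2 ^ Suc j) ^ DIM('a))"
    by (simp add: summable_mult summable_geometric)
  show "\<exists>j. norm z < \<rho> * 2 ^ Suc j \<and>
      (if norm z \<ge> \<rho> then ennreal (norm z powr - \<gamma>) else 0) \<le> ennreal ((\<rho> * 2 ^ j) powr - \<gamma>)"
    if "(if norm z \<ge> \<rho> then ennreal (norm z powr - \<gamma>) else 0) \<noteq> 0" for z :: 'a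
  proof -
    have "norm z \<ge> \<rho>" using that by (auto split: if_splits)
    then obtain j where j: "\<rho> * 2 ^ j \<le> norm z" "norm z < \<rho> * 2 ^ Suc j"
      using dyadic_annulus \<rho> by blast
    have "norm z powr - \<gamma> \<le> (\<rho> * 2 ^ j) powr - \<gamma>"
      using j \<rho> \<gamma> by (intro powr_mono2') auto
    with j show ?thesis using \<open>norm z \<ge> \<rho>\<close> by (intro exI[of _ j]) (auto intro: ennreal_leI)
  qed
qed (use \<rho> in auto)

lemma nn_integral_norm_powr_inside_ball:
  assumes a: "0 \<le> a" "a < real DIM('a)" and \<rho>: "\<rho> > 0"
  shows "(\<integral>\<^sup>+(z::'a::euclidean_space). (if norm z < \<rho> then ennreal (norm z powr - a) else 0) \<partial>lborel) < \<infinity>"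
proof (rule nn_integral_ball_cover_finite[where c = "\<lambda>j. (\<rho> / 2 ^ Suc j) powr - a" and R = "\<lambda>j. 2 * \<rho> / 2 ^ j"])
  have "(\<rho> / 2 ^ Suc j) powr - a * (2 * \<rho> / 2 ^ j) ^ DIM('a) =
      ((\<rho> / 2) powr - a * (2 * \<rho>) ^ DIM('a)) * (2 powr (a - real DIM('a))) ^ j" for j
  proof -
    have "(2 powr (a - real DIM('a))) ^ j = 2 powr (real j * (a - real DIM('a)))"
      by (simp add: powr_powr powr_realpow[symmetric] mult.commute)
    also have "\<dots> = (2 ^ j) powr a / (2 ^ j) ^ DIM('a)"
      by (simp add: powr_realpow[symmetric] powr_powr powr_diff[symmetric] algebra_simps)
    finally show ?thesis
      using \<rho> by (simp add: powr_divide powr_mult power_divide powr_minus field_simps)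
  qed
  moreover have "2 powr (a - real DIM('a)) < 1"
    using a powr_less_mono[of "a - real DIM('a)" 0 2] by simp
  ultimately show "summable (\<lambda>j. (\<rho> / 2 ^ Suc j) powr - a * (2 * \<rho> / 2 ^ j) ^ DIM('a))"
    by (simp add: summable_mult summable_geometric)
  show "\<exists>j. norm z < 2 * \<rho> / 2 ^ j \<and>
      (if norm z < \<rho> then ennreal (norm z powr - a) else 0) \<le> ennreal ((\<rho> / 2 ^ Suc j) powr - a)"
    if "(if norm z < \<rho> then ennreal (norm z powr - a) else 0) \<noteq> 0" for z :: 'a
  proof -
    \<comment> \<open>The origin needs no ball, since \<open>0 powr - a\<close> is 0. Shells
      shrinking to the origin are dyadic annuli for the reciprocal
      \<open>\<rho> / norm z\<close>.\<close>
    have z: "norm z < \<rho>" "norm z > 0" using that by (auto split: if_splits)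
    then obtain j where j: "1 * 2 ^ j \<le> \<rho> / norm z" "\<rho> / norm z < 1 * 2 ^ Suc j"
      using dyadic_annulus[of 1 "\<rho> / norm z"] by (auto simp: field_simps)
    have "norm z powr - a \<le> (\<rho> / 2 ^ Suc j) powr - a"
      using j \<rho> a z by (intro powr_mono2') (auto simp: field_simps)
    moreover have "norm z < 2 * \<rho> / 2 ^ j"
    proof -
      have "norm z \<le> \<rho> / 2 ^ j" using j z by (simp add: field_simps)
      also have "\<dots> < 2 * \<rho> / 2 ^ j" using \<rho> by (simp add: divide_strict_right_mono)
      finally show ?thesis .
    qed
    ultimately show ?thesis using z by (intro exI[of _ j]) (auto intro: ennreal_leI)
  qed
qed (use \<rho> in auto)

lemma japanese_bracket_ge_1: "japanese_bracket x \<ge> 1"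
  by (simp add: japanese_bracket_def)

lemma japanese_bracket_ge_norm: "japanese_bracket x \<ge> norm x"
  unfolding japanese_bracket_def by (rule real_le_rsqrt) simp

lemma borel_measurable_japanese_bracket [measurable]: "japanese_bracket \<in> borel_measurable borel"
  unfolding japanese_bracket_def[abs_def] by measurable

lemma nn_integral_japanese_bracket_powr:
  assumes \<gamma>: "\<gamma> > real CARD('n)"
  shows "(\<integral>\<^sup>+(z::real^'n). ennreal (japanese_bracket z powr - \<gamma>) \<partial>lborel) < \<infinity>"
proof -
  have "\<gamma> > 0" using \<gamma> by (rule le_less_trans[rotated]) simp
  have "(\<integral>\<^sup>+(z::real^'n). ennreal (japanese_bracket z powr - \<gamma>) \<partial>lborel) \<le>
     (\<integral>\<^sup>+(z::real^'n). indicator (ball 0 1) z + (if norm z \<ge> 1 then ennreal (norm z powr - \<gamma>) else 0) \<partial>lborel)"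
  proof (rule nn_integral_mono)
    fix z :: "real^'n"
    have "japanese_bracket z powr - \<gamma> \<le> 1 powr - \<gamma>"
      using japanese_bracket_ge_1[of z] \<open>\<gamma> > 0\<close> by (intro powr_mono2') auto
    moreover have "japanese_bracket z powr - \<gamma> \<le> norm z powr - \<gamma>" if "norm z \<ge> 1"
      using japanese_bracket_ge_norm[of z] \<open>\<gamma> > 0\<close> that by (intro powr_mono2') auto
    ultimately show "ennreal (japanese_bracket z powr - \<gamma>) \<le>
        indicator (ball 0 1) z + (if norm z \<ge> 1 then ennreal (norm z powr - \<gamma>) else 0)"
      by (auto simp: indicator_def ennreal_leI)
  qed
  also have "\<dots> = emeasure lborel (ball (0::real^'n) 1) +
      (\<integral>\<^sup>+(z::real^'n). (if norm z \<ge> 1 then ennreal (norm z powr - \<gamma>) else 0) \<partial>lborel)"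
    by (subst nn_integral_add) (auto intro!: borel_measurable_indicator borel_open)
  also have "\<dots> < \<infinity>"
    using nn_integral_norm_powr_outside_ball[where 'a = "real^'n", of \<gamma> 1] \<gamma> emeasure_lborel_ball_finite[of "0::real^'n" 1]
    by (simp add: ennreal_add_less_top)
  finally show ?thesis .
qed

lemma nn_integral_lborel_reflect:
  fixes g :: "'a::euclidean_space \<Rightarrow> ennreal"
  assumes [measurable]: "g \<in> borel_measurable borel"
  shows "(\<integral>\<^sup>+y. g (x - y) \<partial>lborel) = (\<integral>\<^sup>+y. g y \<partial>lborel)"
proof -
  have "(lborel :: 'a measure) = density (distr lborel borel (\<lambda>y. x + (-1) *\<^sub>R y)) (\<lambda>_. ennreal (\<bar>-1::real\<bar> ^ DIM('a)))"
    by (rule lborel_affine) simp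
  then have "(\<integral>\<^sup>+y. g y \<partial>lborel) =
      (\<integral>\<^sup>+y. g y \<partial>density (distr lborel borel (\<lambda>y. x + (-1) *\<^sub>R y)) (\<lambda>_. ennreal (\<bar>-1::real\<bar> ^ DIM('a))))"
    by (rule arg_cong)
  also have "\<dots> = (\<integral>\<^sup>+y. g (x - y) \<partial>lborel)"
    by (simp add: nn_integral_density nn_integral_distr)
  finally show ?thesis by simp
qed

text \<open>The smaller base raised to the full exponent dominates the product. Applied with
  \<open>s = norm (x - y)\<close> and \<open>t = japanese_bracket y\<close>, this separates the
  kernel from the weight without any case distinction on the position of \<open>y\<close> relative
  to \<open>x\<close>.\<close>

lemma powr_mult_le_sum:
  fixes s t a b :: real
  assumes "s > 0" "t > 0" "a \<ge> 0" "b \<ge> 0"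
  shows "s powr - a * t powr - b \<le> s powr - (a + b) + t powr - (a + b)"
proof (cases "s \<le> t")
  case True
  then have "s powr - a * t powr - b \<le> s powr - a * s powr - b"
    using assms by (intro mult_left_mono powr_mono2') auto
  then show ?thesis by (simp add: powr_add[symmetric] algebra_simps add_increasing2)
next
  case False
  then have "s powr - a * t powr - b \<le> t powr - a * t powr - b"
    using assms by (intro mult_right_mono powr_mono2') auto
  then show ?thesis by (simp add: powr_add[symmetric] algebra_simps add_increasing)
qed

section \<open>Size of the kernel and of the weighted potential\<close>

lemma borel_measurable_helmholtz_\<Phi>:
  assumes k: "k > 0" and N: "CARD('n) \<ge> 3"
  shows "(helmholtz_\<Phi> k :: real^'n \<Rightarrow> complex) \<in> borel_measurable borel"
proof -
  let ?\<nu> = "(real CARD('n) - 2) / 2"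
  have [measurable]: "(\<lambda>r. if r > 0 then hankel1 ?\<nu> r else 0) \<in> borel_measurable borel"
    using N by (intro borel_measurable_hankel1) auto
  \<comment> \<open>At the origin the power factor is \<open>0 powr ?\<nu> = 0\<close>, so cutting
    off the Hankel function there changes nothing.\<close>
  have "(helmholtz_\<Phi> k :: real^'n \<Rightarrow> complex) = (\<lambda>x. \<i> / 4 * complex_of_real ((k / (2 * pi * norm x)) powr ?\<nu>)
       * (\<lambda>r. if r > 0 then hankel1 ?\<nu> r else 0) (k * norm x))"
    using k by (auto simp: helmholtz_\<Phi>_def fun_eq_iff zero_less_mult_iff)
  then show ?thesis by simp
qed

text \<open>The prefactor contributes \<open>norm x powr - \<nu>\<close> with
  \<open>\<nu> = (N - 2) / 2\<close>. Multiplied by the two Hankel bounds it yields the exponents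
  \<open>2 * \<nu> = N - 2\<close> and \<open>\<nu> + 1 / 2 = (N - 1) / 2\<close>. The radius
  \<open>\<rho>\<close> is where \<open>k * norm x\<close> reaches the threshold
  \<open>2 * \<nu> + 2\<close> between the two regimes.\<close>

lemma helmholtz_\<Phi>_bound:
  assumes k: "k > 0" and N: "CARD('n) \<ge> 3"
  obtains C \<rho> where "C \<ge> 0" "\<rho> > 0"
    "\<And>x::real^'n. norm x < \<rho> \<Longrightarrow> cmod (helmholtz_\<Phi> k x) \<le> C * norm x powr - (real CARD('n) - 2)"
    "\<And>x::real^'n. norm x \<ge> \<rho> \<Longrightarrow> cmod (helmholtz_\<Phi> k x) \<le> C * norm x powr - ((real CARD('n) - 1) / 2)"
proof -
  define \<nu> where "\<nu> = (real CARD('n) - 2) / 2"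
  have \<nu>: "\<nu> > 0" using N by (simp add: \<nu>_def)
  obtain C where C: "C \<ge> 0"
    "\<And>r. 0 < r \<Longrightarrow> r \<le> 2 * \<nu> + 2 \<Longrightarrow> cmod (hankel1 \<nu> r) \<le> C * r powr (- \<nu>)"
    "\<And>r. r \<ge> 2 * \<nu> + 2 \<Longrightarrow> cmod (hankel1 \<nu> r) \<le> C * r powr (- 1 / 2)"
    by (rule hankel1_bound[OF \<nu>]) blast
  define \<rho> where "\<rho> = (2 * \<nu> + 2) / k"
  have \<rho>: "\<rho> > 0" using \<nu> k by (simp add: \<rho>_def)
  define D where "D = (k / (2 * pi)) powr \<nu> / 4 * C"
  have D: "D \<ge> 0" using C(1) by (simp add: D_def)
  have \<Phi>: "cmod (helmholtz_\<Phi> k x) = (k / (2 * pi)) powr \<nu> / 4 * norm x powr - \<nu> * cmod (hankel1 \<nu> (k * norm x))"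
    if "x \<noteq> 0" for x :: "real^'n"
    using that k by (simp add: helmholtz_\<Phi>_def \<nu>_def[symmetric] norm_mult norm_divide powr_divide powr_mult powr_minus field_simps)
  show ?thesis
  proof (rule that[of "D * k powr - \<nu> + D * k powr (- 1 / 2)" \<rho>])
    show "0 \<le> D * k powr - \<nu> + D * k powr (- 1 / 2)" using D by simp
    fix x :: "real^'n"
    show "cmod (helmholtz_\<Phi> k x) \<le> (D * k powr - \<nu> + D * k powr (- 1 / 2)) * norm x powr - (real CARD('n) - 2)"
      if x: "norm x < \<rho>"
    proof (cases "x = 0")
      case False
      have "k * norm x \<le> 2 * \<nu> + 2" using x k by (simp add: \<rho>_def field_simps)
      then have "cmod (hankel1 \<nu> (k * norm x)) \<le> C * (k * norm x) powr - \<nu>"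
        using False k by (intro C(2)) auto
      then have "cmod (helmholtz_\<Phi> k x) \<le> (k / (2 * pi)) powr \<nu> / 4 * norm x powr - \<nu> * (C * (k * norm x) powr - \<nu>)"
        unfolding \<Phi>[OF False] by (intro mult_left_mono) auto
      also have "\<dots> = D * k powr - \<nu> * (norm x powr - \<nu> * norm x powr - \<nu>)"
        using k by (simp add: D_def powr_mult)
      also have "norm x powr - \<nu> * norm x powr - \<nu> = norm x powr - (real CARD('n) - 2)"
        by (simp add: powr_add[symmetric] \<nu>_def)
      also have "D * k powr - \<nu> * norm x powr - (real CARD('n) - 2) \<le>
          (D * k powr - \<nu> + D * k powr (- 1 / 2)) * norm x powr - (real CARD('n) - 2)"
        using D by (intro mult_right_mono) auto
      finally show ?thesis .
    qed (simp add: helmholtz_\<Phi>_def)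
    show "cmod (helmholtz_\<Phi> k x) \<le> (D * k powr - \<nu> + D * k powr (- 1 / 2)) * norm x powr - ((real CARD('n) - 1) / 2)"
      if x: "norm x \<ge> \<rho>"
    proof -
      have x0: "x \<noteq> 0" using x \<rho> by auto
      have "k * norm x \<ge> 2 * \<nu> + 2" using x k by (simp add: \<rho>_def field_simps)
      then have "cmod (hankel1 \<nu> (k * norm x)) \<le> C * (k * norm x) powr (- 1 / 2)"
        by (intro C(3)) auto
      then have "cmod (helmholtz_\<Phi> k x) \<le> (k / (2 * pi)) powr \<nu> / 4 * norm x powr - \<nu> * (C * (k * norm x) powr (- 1 / 2))"
        unfolding \<Phi>[OF x0] by (intro mult_left_mono) auto
      also have "\<dots> = D * k powr (- 1 / 2) * (norm x powr - \<nu> * norm x powr (- 1 / 2))"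
        using k by (simp add: D_def powr_mult)
      also have "norm x powr - \<nu> * norm x powr (- 1 / 2) = norm x powr - ((real CARD('n) - 1) / 2)"
        unfolding powr_add[symmetric] \<nu>_def by (rule arg_cong[where f = "\<lambda>a. norm x powr a"]) (simp add: field_simps)
      also have "D * k powr (- 1 / 2) * norm x powr - ((real CARD('n) - 1) / 2) \<le>
          (D * k powr - \<nu> + D * k powr (- 1 / 2)) * norm x powr - ((real CARD('n) - 1) / 2)"
        using D by (intro mult_right_mono) auto
      finally show ?thesis .
    qed
  qed (rule \<rho>)
qed

text \<open>For \<open>y\<close> close to \<open>x\<close> the weight is at most 1 and the
  singularity of order \<open>N - 2\<close> is integrable. Away from \<open>x\<close>,
  \<open>powr_mult_le_sum\<close> leaves one power of \<open>x - y\<close> and one of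
  \<open>y\<close>, both with the exponent \<open>\<gamma> = (N - 1) / 2 + \<beta> > N\<close>.
  Reflection and translation invariance make the integrals independent of \<open>x\<close>.\<close>

lemma weighted_potential_bound:
  assumes k: "k > 0" and N: "CARD('n) \<ge> 3" and \<beta>: "\<beta> > (real CARD('n) + 1) / 2"
  obtains C where "C \<ge> 0"
    "\<And>x::real^'n. (\<integral>\<^sup>+y. ennreal (cmod (helmholtz_\<Phi> k (x - y)) * japanese_bracket y powr - \<beta>) \<partial>lborel) \<le> ennreal C"
proof -
  define a where "a = (real CARD('n) - 1) / 2"
  define \<gamma> where "\<gamma> = a + \<beta>"
  have a: "a \<ge> 0" "\<beta> \<ge> 0" using N \<beta> by (auto simp: a_def)
  have \<gamma>: "\<gamma> > real CARD('n)" using \<beta> by (simp add: \<gamma>_def a_def field_simps)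
  obtain C \<rho> where C: "C \<ge> 0" "\<rho> > 0"
    "\<And>x::real^'n. norm x < \<rho> \<Longrightarrow> cmod (helmholtz_\<Phi> k x) \<le> C * norm x powr - (real CARD('n) - 2)"
    "\<And>x::real^'n. norm x \<ge> \<rho> \<Longrightarrow> cmod (helmholtz_\<Phi> k x) \<le> C * norm x powr - a"
    unfolding a_def by (rule helmholtz_\<Phi>_bound[OF k N]) blast
  define K1 where "K1 z = (if norm z < \<rho> then ennreal (norm z powr - (real CARD('n) - 2)) else 0)" for z :: "real^'n"
  define K2 where "K2 z = (if norm z \<ge> \<rho> then ennreal (norm z powr - \<gamma>) else 0)" for z :: "real^'n"
  define K3 where "K3 z = ennreal (japanese_bracket z powr - \<gamma>)" for z :: "real^'n"
  have [measurable]: "K1 \<in> borel_measurable borel" "K2 \<in> borel_measurable borel" "K3 \<in> borel_measurable borel"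
    unfolding K1_def K2_def K3_def by measurable
  define I where "I = ennreal C * ((\<integral>\<^sup>+z. K1 z \<partial>lborel) + (\<integral>\<^sup>+z. K2 z \<partial>lborel) + (\<integral>\<^sup>+z. K3 z \<partial>lborel))"
  have "(\<integral>\<^sup>+y. ennreal (cmod (helmholtz_\<Phi> k (x - y)) * japanese_bracket y powr - \<beta>) \<partial>lborel) \<le> I" for x :: "real^'n"
  proof -
    have "ennreal (cmod (helmholtz_\<Phi> k (x - y)) * japanese_bracket y powr - \<beta>) \<le>
        ennreal C * (K1 (x - y) + K2 (x - y) + K3 y)" for y
    proof (cases "norm (x - y) < \<rho>")
      case True
      have "japanese_bracket y powr - \<beta> \<le> 1 powr - \<beta>"
        using japanese_bracket_ge_1[of y] a by (intro powr_mono2') auto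
      then have "cmod (helmholtz_\<Phi> k (x - y)) * japanese_bracket y powr - \<beta> \<le>
          C * norm (x - y) powr - (real CARD('n) - 2) * 1"
        using C True by (intro mult_mono) auto
      then have "ennreal (cmod (helmholtz_\<Phi> k (x - y)) * japanese_bracket y powr - \<beta>) \<le> ennreal C * K1 (x - y)"
        using True C(1) by (simp add: K1_def ennreal_mult[symmetric] ennreal_leI)
      also have "\<dots> \<le> ennreal C * (K1 (x - y) + K2 (x - y) + K3 y)"
        by (intro mult_left_mono) (auto simp: add.assoc)
      finally show ?thesis .
    next
      case False
      have "cmod (helmholtz_\<Phi> k (x - y)) * japanese_bracket y powr - \<beta> \<le>
          (C * norm (x - y) powr - a) * japanese_bracket y powr - \<beta>"
        using False by (intro mult_right_mono C) auto
      also have "\<dots> = C * (norm (x - y) powr - a * japanese_bracket y powr - \<beta>)" by simp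
      also have "\<dots> \<le> C * (norm (x - y) powr - \<gamma> + japanese_bracket y powr - \<gamma>)"
        unfolding \<gamma>_def using False C japanese_bracket_ge_1[of y] a
        by (intro mult_left_mono powr_mult_le_sum) auto
      finally have "ennreal (cmod (helmholtz_\<Phi> k (x - y)) * japanese_bracket y powr - \<beta>) \<le>
          ennreal (C * (norm (x - y) powr - \<gamma> + japanese_bracket y powr - \<gamma>))" by (rule ennreal_leI)
      also have "\<dots> = ennreal C * (K2 (x - y) + K3 y)"
        using False C(1) by (simp add: K2_def K3_def ennreal_mult ennreal_plus)
      also have "\<dots> \<le> ennreal C * (K1 (x - y) + K2 (x - y) + K3 y)"
        by (intro mult_left_mono) (auto simp: add.assoc)
      finally show ?thesis .
    qed
    then have "(\<integral>\<^sup>+y. ennreal (cmod (helmholtz_\<Phi> k (x - y)) * japanese_bracket y powr - \<beta>) \<partial>lborel) \<le>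
        (\<integral>\<^sup>+y. ennreal C * (K1 (x - y) + K2 (x - y) + K3 y) \<partial>lborel)"
      by (intro nn_integral_mono)
    also have "\<dots> = I"
      by (simp add: nn_integral_cmult nn_integral_add nn_integral_lborel_reflect I_def)
    finally show ?thesis .
  qed
  moreover have "I < \<infinity>"
  proof -
    have "(\<integral>\<^sup>+z. K1 z \<partial>lborel) < \<infinity>"
      unfolding K1_def using N C(2) by (intro nn_integral_norm_powr_inside_ball) auto
    moreover have "(\<integral>\<^sup>+z. K2 z \<partial>lborel) < \<infinity>"
      unfolding K2_def using \<gamma> C(2) by (intro nn_integral_norm_powr_outside_ball) auto
    moreover have "(\<integral>\<^sup>+z. K3 z \<partial>lborel) < \<infinity>"
      unfolding K3_def by (rule nn_integral_japanese_bracket_powr[OF \<gamma>])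
    ultimately show ?thesis by (simp add: I_def ennreal_mult_less_top ennreal_add_less_top)
  qed
  ultimately show ?thesis
    by (intro that[of "enn2real I"]) (auto simp: ennreal_enn2real)
qed

section \<open>Solution map of a small perturbation of the identity\<close>

text \<open>The equation \<open>v = A v + w\<close> is solved by contraction. The estimate
  \<open>lower\<close> then gives uniqueness, from which linearity of the solution in
  \<open>w\<close> follows, and also the bound 2.\<close>

lemma blinfun_inverse_id_minus:
  fixes A :: "'a::banach \<Rightarrow>\<^sub>L 'a"
  assumes "norm A \<le> 1 / 2"
  obtains B where "\<And>v. blinfun_apply B (v - A v) = v" "\<And>v. blinfun_apply B v - A (B v) = v" "norm B \<le> 2"
proof -
  have lower: "norm v \<le> 2 * norm (v - A v)" for v
  proof -
    have "norm (A v) \<le> norm v / 2"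
      using norm_blinfun[of A v] mult_right_mono[OF assms, of "norm v"] by simp
    moreover have "norm v \<le> norm (v - A v) + norm (A v)" by (metis diff_add_cancel norm_triangle_ineq)
    ultimately show ?thesis by simp
  qed
  have "\<exists>v. v - A v = w" for w
  proof -
    have "\<exists>!v. (\<lambda>v. A v + w) v = v"
    proof (rule banach_fix_type[of "1 / 2"])
      show "\<forall>x y. dist (A x + w) (A y + w) \<le> 1 / 2 * dist x y"
      proof (intro allI)
        fix x y
        have "norm (A (x - y)) \<le> 1 / 2 * norm (x - y)"
          using norm_blinfun[of A "x - y"] mult_right_mono[OF assms, of "norm (x - y)"] by simp
        then show "dist (A x + w) (A y + w) \<le> 1 / 2 * dist x y"
          by (simp add: dist_norm blinfun.diff_right)
      qed
    qed auto
    then obtain v where "A v + w = v" by blast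
    then have "v - A v = w" by (simp add: diff_eq_eq add.commute)
    then show ?thesis ..
  qed
  then obtain b where b: "\<And>w. b w - A (b w) = w" by metis
  have inj: "v = v'" if "v - A v = v' - A v'" for v v'
    using lower[of "v - v'"] that by (simp add: blinfun.diff_right algebra_simps)
  have "bounded_linear b"
  proof (rule bounded_linear_intro[where K = 2])
    show "b (x + y) = b x + b y" for x y
    proof (rule inj)
      have "b x + b y - A (b x + b y) = (b x - A (b x)) + (b y - A (b y))"
        by (simp add: blinfun.add_right)
      then show "b (x + y) - A (b (x + y)) = b x + b y - A (b x + b y)" by (simp only: b)
    qed
    show "b (r *\<^sub>R x) = r *\<^sub>R b x" for r x
      by (rule inj) (simp add: b blinfun.scaleR_right scaleR_diff_right[symmetric])
    show "norm (b x) \<le> norm x * 2" for x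
      using lower[of "b x"] by (simp add: b)
  qed
  then have B: "blinfun_apply (Blinfun b) = b" by (rule bounded_linear_Blinfun_apply)
  show ?thesis
  proof (rule that[of "Blinfun b"])
    show "blinfun_apply (Blinfun b) (v - A v) = v" for v unfolding B by (rule inj) (rule b)
    show "blinfun_apply (Blinfun b) v - A (blinfun_apply (Blinfun b) v) = v" for v unfolding B by (rule b)
    show "norm (Blinfun b) \<le> 2"
      by (rule norm_blinfun_bound) (use lower[of "b _"] in \<open>auto simp: B b\<close>)
  qed
qed

text \<open>On a ball where \<open>F'\<close> is smaller than 1/2, \<open>F\<close> is a contraction
  and \<open>u - F u\<close> expands distances by at least 1/2. So solutions are unique in the whole
  ball \<open>U\<close>, and \<open>g\<close> is Lipschitz with constant 2. The derivative of
  \<open>g\<close> is the inverse of the identity minus \<open>F' (g \<phi>)\<close>.\<close>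

lemma local_C1_solution:
  fixes F :: "'a::banach \<Rightarrow> 'a" and F' :: "'a \<Rightarrow> 'a \<Rightarrow>\<^sub>L 'a"
  assumes deriv: "\<And>u. (F has_derivative blinfun_apply (F' u)) (at u)"
    and cont: "continuous_on UNIV F'"
    and F0: "F 0 = 0" and F'0: "F' 0 = 0"
  obtains U V g g' where "open U" "0 \<in> U" "open V" "0 \<in> V"
    "\<And>\<phi> u. \<phi> \<in> V \<Longrightarrow> (u \<in> U \<and> u = F u + \<phi>) \<longleftrightarrow> u = g \<phi>"
    "\<And>\<phi>. \<phi> \<in> V \<Longrightarrow> (g has_derivative blinfun_apply (g' \<phi> :: 'a \<Rightarrow>\<^sub>L 'a)) (at \<phi>)"
    "continuous_on V g'"
proof -
  obtain r where r: "r > 0" "\<And>u. norm u < r \<Longrightarrow> norm (F' u) < 1 / 2"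
  proof -
    have "isCont F' 0" using cont by (simp add: continuous_on_eq_continuous_at)
    then obtain r where "r > 0" "\<And>u. dist u 0 < r \<Longrightarrow> dist (F' u) (F' 0) < 1 / 2"
      unfolding continuous_at_eps_delta by (metis half_gt_zero zero_less_one)
    then show ?thesis using that F'0 by simp
  qed
  have lip: "norm (F u - F v) \<le> 1 / 2 * norm (u - v)" if "norm u < r" "norm v < r" for u v
  proof (rule differentiable_bound[of "ball 0 r"])
    show "(F has_derivative blinfun_apply (F' x)) (at x within ball 0 r)" for x
      using deriv by (rule has_derivative_at_withinI)
    show "onorm (blinfun_apply (F' x)) \<le> 1 / 2" if "x \<in> ball 0 r" for x
      using r(2)[of x] that by (simp add: norm_blinfun.rep_eq)
  qed (use that in auto)
  define V where "V = ball (0::'a) (r / 2)"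
  have ex: "\<exists>u. norm u < r \<and> u = F u + \<phi>" if "\<phi> \<in> V" for \<phi>
  proof -
    \<comment> \<open>On the ball of radius \<open>t\<close>, \<open>F\<close> has norm at most
      \<open>t / 2 = norm \<phi>\<close>, so adding \<open>\<phi>\<close> stays in that ball. The
      radius r/2 of \<open>V\<close> makes \<open>t < r\<close>.\<close>
    define t where "t = 2 * norm \<phi>"
    have t: "0 \<le> t" "t < r" using that by (auto simp: t_def V_def)
    have "\<exists>!u. u \<in> cball 0 t \<and> F u + \<phi> = u"
    proof (rule Banach_fix[of _ "1 / 2"])
      show "complete (cball (0::'a) t)" by (simp add: complete_eq_closed)
      show "cball (0::'a) t \<noteq> {}" using t by simp
      show "(\<lambda>u. F u + \<phi>) ` cball 0 t \<subseteq> cball 0 t"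
      proof safe
        fix u :: 'a assume "u \<in> cball 0 t"
        with t have "norm (F u) \<le> 1 / 2 * t"
          using lip[of u 0] F0 by simp
        then show "F u + \<phi> \<in> cball 0 t"
          using norm_triangle_ineq[of "F u" \<phi>] by (simp add: t_def)
      qed
      show "dist (F x + \<phi>) (F y + \<phi>) \<le> 1 / 2 * dist x y" if "x \<in> cball 0 t" "y \<in> cball 0 t" for x y
        using lip[of x y] that t by (simp add: dist_norm)
    qed auto
    then show ?thesis using t by (metis le_less_trans mem_cball_0)
  qed
  then obtain g where g: "\<And>\<phi>. \<phi> \<in> V \<Longrightarrow> norm (g \<phi>) < r" "\<And>\<phi>. \<phi> \<in> V \<Longrightarrow> g \<phi> - F (g \<phi>) = \<phi>"
    by (metis add_diff_cancel_left')
  have lower: "norm (u - v) \<le> 2 * norm ((u - F u) - (v - F v))" if "norm u < r" "norm v < r" for u v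
  proof -
    have "norm (u - v) \<le> norm ((u - F u) - (v - F v)) + norm (F u - F v)"
      using norm_triangle_ineq[of "(u - F u) - (v - F v)" "F u - F v"] by simp
    with lip[OF that] show ?thesis by simp
  qed
  have g_lip: "norm (g \<phi> - g \<psi>) \<le> 2 * norm (\<phi> - \<psi>)" if "\<phi> \<in> V" "\<psi> \<in> V" for \<phi> \<psi>
    using lower[of "g \<phi>" "g \<psi>"] g that by simp
  have g_cont: "continuous_on V g"
    unfolding continuous_on_iff
  proof (intro ballI allI impI)
    fix \<phi> and e :: real assume "\<phi> \<in> V" "0 < e"
    then show "\<exists>d>0. \<forall>\<psi>\<in>V. dist \<psi> \<phi> < d \<longrightarrow> dist (g \<psi>) (g \<phi>) < e"
      using g_lip by (intro exI[of _ "e / 2"]) (fastforce simp: dist_norm)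
  qed
  have "\<exists>B. (\<forall>v. blinfun_apply B (v - F' (g \<phi>) v) = v) \<and> (\<forall>v. B v - F' (g \<phi>) (B v) = v) \<and> norm B \<le> 2"
    if "\<phi> \<in> V" for \<phi>
    using blinfun_inverse_id_minus[of "F' (g \<phi>)"] r(2)[OF g(1)[OF that]] by (metis less_imp_le)
  then obtain g' where g': "\<And>\<phi> v. \<phi> \<in> V \<Longrightarrow> blinfun_apply (g' \<phi>) (v - F' (g \<phi>) v) = v"
      "\<And>\<phi> v. \<phi> \<in> V \<Longrightarrow> blinfun_apply (g' \<phi>) v - F' (g \<phi>) (g' \<phi> v) = v"
      "\<And>\<phi>. \<phi> \<in> V \<Longrightarrow> norm (g' \<phi>) \<le> 2"
    by metis
  \<comment> \<open>The resolvent identity: for \<open>B\<close> and \<open>B'\<close> inverse to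
    the identity minus \<open>A\<close> and \<open>A'\<close>, the difference \<open>B - B'\<close>
    is the composition of \<open>B\<close>, \<open>A - A'\<close> and \<open>B'\<close>. The
    constant is 4 = 2 * 2.\<close>
  have g'_diff: "norm (g' \<phi> - g' \<psi>) \<le> 4 * norm (F' (g \<phi>) - F' (g \<psi>))" if "\<phi> \<in> V" "\<psi> \<in> V" for \<phi> \<psi>
  proof (rule norm_blinfun_bound)
    fix v :: 'a
    define w where "w = g' \<psi> v"
    have "(g' \<phi> - g' \<psi>) v = g' \<phi> ((F' (g \<phi>) - F' (g \<psi>)) w)"
    proof -
      have "(g' \<phi> - g' \<psi>) v = g' \<phi> v - w" by (simp add: blinfun.diff_left w_def)
      also have "\<dots> = g' \<phi> (w - F' (g \<psi>) w) - g' \<phi> (w - F' (g \<phi>) w)"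
        using g'(2)[OF that(2), of v] g'(1)[OF that(1), of w] by (simp add: w_def)
      also have "\<dots> = g' \<phi> ((F' (g \<phi>) - F' (g \<psi>)) w)"
        by (simp add: blinfun.diff_right[symmetric] blinfun.diff_left)
      finally show ?thesis .
    qed
    also have "norm \<dots> \<le> norm (g' \<phi>) * (norm (F' (g \<phi>) - F' (g \<psi>)) * (norm (g' \<psi>) * norm v))"
      unfolding w_def
      by (intro order_trans[OF norm_blinfun] mult_left_mono norm_ge_zero order_refl)
    also have "\<dots> = (norm (g' \<phi>) * norm (g' \<psi>)) * (norm (F' (g \<phi>) - F' (g \<psi>)) * norm v)"
      by (simp only: mult_ac)
    also have "\<dots> \<le> (2 * 2) * (norm (F' (g \<phi>) - F' (g \<psi>)) * norm v)"
      by (rule mult_right_mono[OF mult_mono]) (simp_all add: g'(3) that)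
    finally show "norm ((g' \<phi> - g' \<psi>) v) \<le> 4 * norm (F' (g \<phi>) - F' (g \<psi>)) * norm v" by (simp add: mult.assoc)
  qed auto
  have F'g_cont: "continuous_on V (\<lambda>\<phi>. F' (g \<phi>))"
    by (rule continuous_on_compose2[OF cont g_cont]) auto
  have "continuous_on V g'"
    unfolding continuous_on_def
  proof
    fix \<phi> assume \<phi>: "\<phi> \<in> V"
    show "(g' \<longlongrightarrow> g' \<phi>) (at \<phi> within V)"
    proof (rule Lim_null_comparison[THEN LIM_zero_cancel])
      show "\<forall>\<^sub>F \<psi> in at \<phi> within V. norm (g' \<psi> - g' \<phi>) \<le> 4 * norm (F' (g \<psi>) - F' (g \<phi>))"
        using g'_diff \<phi> by (auto simp: eventually_at_filter)
      have "((\<lambda>\<psi>. F' (g \<psi>)) \<longlongrightarrow> F' (g \<phi>)) (at \<phi> within V)"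
        using F'g_cont \<phi> by (simp add: continuous_on_def)
      then show "((\<lambda>\<psi>. 4 * norm (F' (g \<psi>) - F' (g \<phi>))) \<longlongrightarrow> 0) (at \<phi> within V)"
        by (intro tendsto_mult_right_zero tendsto_norm_zero LIM_zero)
    qed
  qed
  moreover have "(g has_derivative blinfun_apply (g' \<phi>)) (at \<phi>)" if \<phi>: "\<phi> \<in> V" for \<phi>
  proof (rule has_derivative_inverse_basic[where f = "\<lambda>u. u - F u" and T = V])
    show "((\<lambda>u. u - F u) has_derivative (\<lambda>v. v - F' (g \<phi>) v)) (at (g \<phi>))"
      by (intro has_derivative_diff has_derivative_ident deriv)
    show "bounded_linear (blinfun_apply (g' \<phi>))" by (rule blinfun.bounded_linear_right)
    show "blinfun_apply (g' \<phi>) \<circ> (\<lambda>v. v - F' (g \<phi>) v) = id"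
      using g'(1)[OF \<phi>] by auto
    show "continuous (at \<phi>) g"
      using g_cont \<phi> by (simp add: V_def continuous_on_eq_continuous_at)
  qed (use \<phi> g in \<open>auto simp: V_def\<close>)
  moreover have "(u \<in> ball 0 r \<and> u = F u + \<phi>) \<longleftrightarrow> u = g \<phi>" if "\<phi> \<in> V" for \<phi> u
  proof
    assume u: "u \<in> ball 0 r \<and> u = F u + \<phi>"
    then have "u - F u = \<phi>" by (simp add: diff_eq_eq add.commute)
    with lower[of u "g \<phi>"] u g that show "u = g \<phi>" by simp
  next
    assume "u = g \<phi>"
    with g[OF that] show "u \<in> ball 0 r \<and> u = F u + \<phi>"
      by (auto simp: algebra_simps)
  qed
  ultimately show ?thesis
    using \<open>r > 0\<close> by (intro that[of "ball 0 r" V]) (auto simp: V_def)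
qed

section \<open>The resolvent and the substitution operator\<close>

lemma lebesgue_complex_borel_AE:
  fixes h :: "'a::euclidean_space \<Rightarrow> complex"
  assumes [measurable]: "h \<in> borel_measurable lebesgue"
  obtains h' where "h' \<in> borel_measurable borel" "AE x in lebesgue. h x = h' x"
proof -
  obtain a where a: "a \<in> borel_measurable lborel" "AE x in lborel. Re (h x) = a x"
    using completion_ex_borel_measurable_real[of "\<lambda>x. Re (h x)" lborel] by auto
  obtain b where b: "b \<in> borel_measurable lborel" "AE x in lborel. Im (h x) = b x"
    using completion_ex_borel_measurable_real[of "\<lambda>x. Im (h x)" lborel] by auto
  have "AE x in lborel. h x = complex_of_real (a x) + \<i> * complex_of_real (b x)"
    using a(2) b(2) by eventually_elim (simp add: complex_eq_iff)
  then have "AE x in lebesgue. h x = complex_of_real (a x) + \<i> * complex_of_real (b x)"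
    by (rule AE_completion)
  with a(1) b(1) show ?thesis
    by (intro that[of "\<lambda>x. complex_of_real (a x) + \<i> * complex_of_real (b x)"]) auto
qed

lemma borel_imp_lebesgue_measurable:
  "g \<in> borel_measurable borel \<Longrightarrow> g \<in> borel_measurable lebesgue"
  by (rule measurable_completion) simp

text \<open>Membership in the weighted space
  \<open>\<langle>x\<rangle> powr (-\<beta>) L\<^sup>\<infinity>\<close> with norm at most
  \<open>c\<close>, as a predicate on functions, so that this space needs no quotient type of its
  own.\<close>

definition weight_bounded :: "real \<Rightarrow> (real^'n \<Rightarrow> complex) \<Rightarrow> real \<Rightarrow> bool" where
  "weight_bounded \<beta> h c \<longleftrightarrow> h \<in> borel_measurable lebesgue \<and> c \<ge> 0 \<and>
     (AE y in lebesgue. cmod (h y) \<le> c * japanese_bracket y powr - \<beta>)"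

lemma weight_boundedD:
  assumes "weight_bounded \<beta> h c"
  shows "h \<in> borel_measurable lebesgue" "c \<ge> 0"
    "AE y in lebesgue. cmod (h y) \<le> c * japanese_bracket y powr - \<beta>"
  using assms by (auto simp: weight_bounded_def)

lemma weight_bounded_add:
  assumes "weight_bounded \<beta> g c" "weight_bounded \<beta> h d"
  shows "weight_bounded \<beta> (\<lambda>y. g y + h y) (c + d)"
proof -
  have "AE y in lebesgue. cmod (g y + h y) \<le> (c + d) * japanese_bracket y powr - \<beta>"
    using weight_boundedD(3)[OF assms(1)] weight_boundedD(3)[OF assms(2)]
    by eventually_elim (simp add: distrib_right norm_triangle_mono)
  then show ?thesis using assms by (auto simp: weight_bounded_def)
qed

lemma weight_bounded_scaleR:
  assumes "weight_bounded \<beta> g c"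
  shows "weight_bounded \<beta> (\<lambda>y. r *\<^sub>R g y) (\<bar>r\<bar> * c)"
proof -
  have "AE y in lebesgue. cmod (r *\<^sub>R g y) \<le> \<bar>r\<bar> * c * japanese_bracket y powr - \<beta>"
    using weight_boundedD(3)[OF assms] by eventually_elim (simp add: mult.assoc mult_left_mono)
  then show ?thesis using assms by (auto simp: weight_bounded_def)
qed

text \<open>The dimension occurs in no other argument, hence the \<open>itself\<close> parameter.\<close>

definition resolvent_bounded_by :: "'n::finite itself \<Rightarrow> real \<Rightarrow> real \<Rightarrow> real \<Rightarrow> bool" where
  "resolvent_bounded_by _ k \<beta> C \<longleftrightarrow> C \<ge> 0 \<and> (helmholtz_\<Phi> k :: real^'n \<Rightarrow> complex) \<in> borel_measurable borel \<and>
     (\<forall>x::real^'n. (\<integral>\<^sup>+y. ennreal (cmod (helmholtz_\<Phi> k (x - y)) * japanese_bracket y powr - \<beta>) \<partial>lborel) \<le> ennreal C)"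

definition linf_resolvent :: "real \<Rightarrow> (real^'n \<Rightarrow> complex) \<Rightarrow> (real^'n) linf" where
  "linf_resolvent k h = abs_linf (resolvent k h)"

context
  fixes k \<beta> C :: real and N :: "'n::finite itself"
  assumes bound: "resolvent_bounded_by N k \<beta> C"
begin

lemma resolvent_bounded_by_nonneg: "C \<ge> 0"
  using bound by (simp add: resolvent_bounded_by_def)

lemma helmholtz_borel [measurable]: "(helmholtz_\<Phi> k :: real^'n \<Rightarrow> complex) \<in> borel_measurable borel"
  using bound by (simp add: resolvent_bounded_by_def)

lemma helmholtz_shift_lebesgue: "(\<lambda>y::real^'n. helmholtz_\<Phi> k (x - y)) \<in> borel_measurable lebesgue"
  by (rule borel_imp_lebesgue_measurable) measurable

lemma resolvent_integrand:
  fixes h :: "real^'n \<Rightarrow> complex"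
  assumes h: "weight_bounded \<beta> h c"
  shows "integrable lebesgue (\<lambda>y. helmholtz_\<Phi> k (x - y) * h y)"
    and "cmod (resolvent k h x) \<le> C * c"
proof -
  note [measurable] = weight_boundedD(1)[OF h] helmholtz_shift_lebesgue
  have "(\<integral>\<^sup>+y. ennreal (cmod (helmholtz_\<Phi> k (x - y) * h y)) \<partial>lebesgue) \<le>
      (\<integral>\<^sup>+y. ennreal c * ennreal (cmod (helmholtz_\<Phi> k (x - y)) * japanese_bracket y powr - \<beta>) \<partial>lebesgue)"
    using weight_boundedD(3)[OF h]
  proof (intro nn_integral_mono_AE, eventually_elim)
    case (elim y)
    have "cmod (helmholtz_\<Phi> k (x - y) * h y) \<le> cmod (helmholtz_\<Phi> k (x - y)) * (c * japanese_bracket y powr - \<beta>)"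
      unfolding norm_mult by (intro mult_left_mono elim) auto
    also have "\<dots> = c * (cmod (helmholtz_\<Phi> k (x - y)) * japanese_bracket y powr - \<beta>)" by simp
    finally show ?case
      using weight_boundedD(2)[OF h] by (simp add: ennreal_mult[symmetric] ennreal_leI)
  qed
  also have "\<dots> = ennreal c * (\<integral>\<^sup>+y. ennreal (cmod (helmholtz_\<Phi> k (x - y)) * japanese_bracket y powr - \<beta>) \<partial>lborel)"
    by (simp add: nn_integral_completion nn_integral_cmult)
  also have "\<dots> \<le> ennreal c * ennreal C"
    using bound by (intro mult_left_mono) (auto simp: resolvent_bounded_by_def)
  also have "\<dots> = ennreal (C * c)"
    using weight_boundedD(2)[OF h] resolvent_bounded_by_nonneg by (simp add: ennreal_mult mult.commute)
  finally have *: "(\<integral>\<^sup>+y. ennreal (cmod (helmholtz_\<Phi> k (x - y) * h y)) \<partial>lebesgue) \<le> ennreal (C * c)" .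
  show int: "integrable lebesgue (\<lambda>y. helmholtz_\<Phi> k (x - y) * h y)"
  proof (rule integrableI_bounded)
    show "(\<integral>\<^sup>+y. ennreal (cmod (helmholtz_\<Phi> k (x - y) * h y)) \<partial>lebesgue) < \<infinity>"
      using le_less_trans[OF * ennreal_less_top] by simp
  qed measurable
  have "ennreal (cmod (resolvent k h x)) \<le> (\<integral>\<^sup>+y. ennreal (cmod (helmholtz_\<Phi> k (x - y) * h y)) \<partial>lebesgue)"
    unfolding resolvent_def convolution_def by (rule integral_norm_bound_ennreal[OF int])
  also note *
  finally show "cmod (resolvent k h x) \<le> C * c"
    using weight_boundedD(2)[OF h] resolvent_bounded_by_nonneg by simp
qed

lemma resolvent_cong_AE:
  fixes g h :: "real^'n \<Rightarrow> complex"
  assumes [measurable]: "g \<in> borel_measurable lebesgue" "h \<in> borel_measurable lebesgue"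
    and "AE y in lebesgue. g y = h y"
  shows "resolvent k g = resolvent k h"
proof
  fix x
  note [measurable] = helmholtz_shift_lebesgue
  show "resolvent k g x = resolvent k h x"
    unfolding resolvent_def convolution_def
    by (intro integral_cong_AE) (use assms(3) in \<open>auto elim: eventually_mono\<close>)
qed

text \<open>Measurability in \<open>x\<close> rests on joint Borel measurability of the integrand in
  \<open>x\<close> and \<open>y\<close>. Therefore \<open>h\<close> is first replaced by a Borel
  representative, which changes the convolution at no point.\<close>

lemma ess_bounded_resolvent:
  fixes h :: "real^'n \<Rightarrow> complex"
  assumes h: "weight_bounded \<beta> h c"
  shows "ess_bounded (resolvent k h)"
  unfolding ess_bounded_iff
proof
  obtain h' where h' [measurable]: "h' \<in> borel_measurable borel" and ae: "AE x in lebesgue. h x = h' x"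
    using lebesgue_complex_borel_AE[OF weight_boundedD(1)[OF h]] by blast
  have "resolvent k h = resolvent k h'"
    by (rule resolvent_cong_AE[OF weight_boundedD(1)[OF h] borel_imp_lebesgue_measurable[OF h'] ae])
  also have "\<dots> = (\<lambda>x. \<integral>y. helmholtz_\<Phi> k (x - y) * h' y \<partial>lborel)"
    unfolding resolvent_def convolution_def by (intro ext integral_completion) measurable
  also have "\<dots> \<in> borel_measurable borel"
    by (intro lborel.borel_measurable_lebesgue_integral) measurable
  finally show "resolvent k h \<in> borel_measurable lebesgue"
    by (rule borel_imp_lebesgue_measurable)
  show "\<exists>D\<ge>0. AE x in lebesgue. cmod (resolvent k h x) \<le> D"
    using resolvent_integrand(2)[OF h] weight_boundedD(2)[OF h] resolvent_bounded_by_nonneg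
    by (intro exI[of _ "C * c"]) auto
qed

lemma rep_linf_resolvent:
  fixes h :: "real^'n \<Rightarrow> complex"
  assumes "weight_bounded \<beta> h c"
  shows "AE x in lebesgue. rep_linf (linf_resolvent k h) x = resolvent k h x"
  unfolding linf_resolvent_def by (rule rep_abs_linf[OF ess_bounded_resolvent[OF assms]])

lemma norm_linf_resolvent:
  fixes h :: "real^'n \<Rightarrow> complex"
  assumes "weight_bounded \<beta> h c"
  shows "norm (linf_resolvent k h) \<le> C * c"
  by (rule norm_linf_le)
    (use rep_linf_resolvent[OF assms] in eventually_elim, simp add: resolvent_integrand(2)[OF assms])

lemma linf_resolvent_add:
  fixes g h :: "real^'n \<Rightarrow> complex"
  assumes "weight_bounded \<beta> g c" "weight_bounded \<beta> h d"
  shows "linf_resolvent k (\<lambda>y. g y + h y) = linf_resolvent k g + linf_resolvent k h"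
proof (rule linf_eqI)
  have eq: "resolvent k (\<lambda>y. g y + h y) x = resolvent k g x + resolvent k h x" for x
    unfolding resolvent_def convolution_def
    using resolvent_integrand(1)[OF assms(1), of x] resolvent_integrand(1)[OF assms(2), of x]
    by (simp add: distrib_left)
  show "AE x in lebesgue. rep_linf (linf_resolvent k (\<lambda>y. g y + h y)) x =
      rep_linf (linf_resolvent k g + linf_resolvent k h) x"
    using rep_linf_resolvent[OF weight_bounded_add[OF assms]] rep_linf_resolvent[OF assms(1)]
      rep_linf_resolvent[OF assms(2)] rep_linf_add[of "linf_resolvent k g" "linf_resolvent k h"]
    by eventually_elim (simp add: eq)
qed

lemma linf_resolvent_scaleR:
  fixes g :: "real^'n \<Rightarrow> complex"
  assumes "weight_bounded \<beta> g c"
  shows "linf_resolvent k (\<lambda>y. r *\<^sub>R g y) = r *\<^sub>R linf_resolvent k g"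
proof (rule linf_eqI)
  have eq: "resolvent k (\<lambda>y. r *\<^sub>R g y) x = r *\<^sub>R resolvent k g x" for x
    unfolding resolvent_def convolution_def by simp
  show "AE x in lebesgue. rep_linf (linf_resolvent k (\<lambda>y. r *\<^sub>R g y)) x =
      rep_linf (r *\<^sub>R linf_resolvent k g) x"
    using rep_linf_resolvent[OF weight_bounded_scaleR[OF assms, of r]] rep_linf_resolvent[OF assms]
      rep_linf_scaleR[of r "linf_resolvent k g"]
    by eventually_elim (simp add: eq)
qed

lemma linf_resolvent_diff:
  fixes g h :: "real^'n \<Rightarrow> complex"
  assumes "weight_bounded \<beta> g c" "weight_bounded \<beta> h d"
  shows "linf_resolvent k (\<lambda>y. g y - h y) = linf_resolvent k g - linf_resolvent k h"
  using linf_resolvent_add[OF assms(1) weight_bounded_scaleR[OF assms(2), of "- 1"]]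
    linf_resolvent_scaleR[OF assms(2), of "- 1"]
  by simp

end

section \<open>Pointwise estimates for the nonlinearity\<close>

lemma borel_measurable_rep_linf [measurable]: "rep_linf u \<in> borel_measurable lebesgue"
  using rep_linf_bounded[of u] by (simp add: ess_bounded_def)

lemma continuous_image_lebesgue_measurable:
  fixes g :: "'a::euclidean_space \<Rightarrow> 'b::{second_countable_topology, metric_space} \<Rightarrow> 'c::metric_space"
  assumes "continuous_on UNIV (\<lambda>(x, u). g x u)" and [measurable]: "u \<in> borel_measurable lebesgue"
  shows "(\<lambda>x. g x (u x)) \<in> borel_measurable lebesgue"
proof -
  have [measurable]: "(\<lambda>x::'a. x) \<in> borel_measurable lebesgue"
    by (rule borel_imp_lebesgue_measurable) simp
  have "(\<lambda>x. (x, u x)) \<in> borel_measurable lebesgue" by measurable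
  from borel_measurable_continuous_on[OF assms(1) this] show ?thesis by simp
qed

text \<open>The slack \<open>\<beta> < \<alpha>\<close> in the weight makes the tail uniformly small and leaves a compact set,
  where \<open>f'\<close> is uniformly continuous.\<close>

lemma weighted_uniform_continuity:
  fixes f' :: "real^'n \<Rightarrow> 'b::euclidean_space \<Rightarrow> 'c::real_normed_vector"
  assumes cont: "continuous_on UNIV (\<lambda>(x, u). f' x u)"
    and \<alpha>\<beta>: "0 \<le> \<beta>" "\<beta> < \<alpha>"
    and D: "\<And>x u. norm u \<le> M \<Longrightarrow> norm (f' x u) \<le> D * japanese_bracket x powr - \<alpha>" "D \<ge> 0"
    and e: "e > 0"
  obtains d where "d > 0"
    "\<And>x a b. norm a \<le> M \<Longrightarrow> norm b \<le> M \<Longrightarrow> norm (a - b) < d \<Longrightarrow>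
       norm (f' x a - f' x b) \<le> e * japanese_bracket x powr - \<beta>"
proof -
  \<comment> \<open>This \<open>R\<close> solves
    \<open>e * R powr (\<alpha> - \<beta>) = 2 * D + 1\<close>; beyond it the slack in the exponent
    outweighs the bounds of both terms of the difference.\<close>
  define R where "R = ((2 * D + 1) / e) powr (1 / (\<alpha> - \<beta>))"
  have tail: "2 * D * japanese_bracket x powr - \<alpha> \<le> e * japanese_bracket x powr - \<beta>"
    if "norm x > R" for x :: "real^'n"
  proof -
    define s where "s = japanese_bracket x"
    have s: "s \<ge> 1" "s \<ge> R"
      using japanese_bracket_ge_1[of x] japanese_bracket_ge_norm[of x] that by (auto simp: s_def)
    have "(2 * D + 1) / e = R powr (\<alpha> - \<beta>)"
      using \<alpha>\<beta> e D(2) by (simp add: R_def powr_powr)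
    also have "\<dots> \<le> s powr (\<alpha> - \<beta>)"
      using s \<alpha>\<beta> by (intro powr_mono2) (auto simp: R_def)
    finally have "2 * D \<le> e * s powr (\<alpha> - \<beta>)"
      using e by (simp add: field_simps)
    then have "2 * D * s powr - \<alpha> \<le> e * s powr (\<alpha> - \<beta>) * s powr - \<alpha>"
      by (rule mult_right_mono) simp
    also have "\<dots> = e * s powr - \<beta>" by (simp add: mult.assoc powr_add[symmetric])
    finally show ?thesis by (simp add: s_def)
  qed
  \<comment> \<open>A positive lower bound of the right-hand side over the ball of radius
    \<open>R\<close>, because \<open>japanese_bracket x \<le> 1 + norm x\<close>. One modulus of
    uniform continuity for \<open>w\<close> then serves all these \<open>x\<close>.\<close>
  define w where "w = e * (1 + R) powr - \<beta>"
  have "R \<ge> 0" by (simp add: R_def)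
  then have w: "w > 0" using e by (simp add: w_def)
  have w_le: "w \<le> e * japanese_bracket x powr - \<beta>" if "norm x \<le> R" for x :: "real^'n"
  proof -
    have "japanese_bracket x \<le> 1 + norm x"
      unfolding japanese_bracket_def by (rule real_le_lsqrt) (auto simp: power2_sum)
    then have "(1 + R) powr - \<beta> \<le> japanese_bracket x powr - \<beta>"
      using that \<alpha>\<beta> japanese_bracket_ge_1[of x] by (intro powr_mono2') auto
    then show ?thesis using e by (simp add: w_def)
  qed
  have "uniformly_continuous_on (cball 0 R \<times> cball 0 M) (\<lambda>(x, u). f' x u)"
    by (intro compact_uniformly_continuous continuous_on_subset[OF cont] compact_Times compact_cball) simp
  then obtain d where d: "d > 0"
    "\<And>p q. p \<in> cball 0 R \<times> cball 0 M \<Longrightarrow> q \<in> cball 0 R \<times> cball 0 M \<Longrightarrow> dist q p < d \<Longrightarrow>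
       dist ((\<lambda>(x, u). f' x u) q) ((\<lambda>(x, u). f' x u) p) < w"
    unfolding uniformly_continuous_on_def using w by metis
  show ?thesis
  proof (rule that[OF d(1)])
    fix x :: "real^'n" and a b :: 'b assume ab: "norm a \<le> M" "norm b \<le> M" "norm (a - b) < d"
    show "norm (f' x a - f' x b) \<le> e * japanese_bracket x powr - \<beta>"
    proof (cases "norm x \<le> R")
      case True
      have "dist (x, a) (x, b) < d" using ab by (simp add: dist_Pair_Pair dist_norm)
      then have "norm (f' x a - f' x b) < w"
        using d(2)[of "(x, b)" "(x, a)"] True ab by (simp add: dist_norm)
      with w_le[OF True] show ?thesis by simp
    next
      case False
      have "norm (f' x a - f' x b) \<le> norm (f' x a) + norm (f' x b)" by (rule norm_triangle_ineq4)
      also have "\<dots> \<le> 2 * D * japanese_bracket x powr - \<alpha>"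
        using D(1)[OF ab(1), of x] D(1)[OF ab(2), of x] by simp
      also have "\<dots> \<le> e * japanese_bracket x powr - \<beta>" using tail False by simp
      finally show ?thesis .
    qed
  qed
qed

text \<open>By convexity the segment from \<open>a\<close> to \<open>b\<close> stays in the ball of
  radius \<open>M\<close> and within \<open>d\<close> of \<open>a\<close>, so a local modulus of
  continuity of \<open>g'\<close> suffices for the mean value inequality.\<close>

lemma linearization_error_bound:
  fixes g :: "'a::real_normed_vector \<Rightarrow> 'b::real_normed_vector" and g' :: "'a \<Rightarrow> 'a \<Rightarrow>\<^sub>L 'b"
  assumes deriv: "\<And>x. (g has_derivative blinfun_apply (g' x)) (at x)"
    and ab: "norm a \<le> M" "norm b \<le> M" "norm (b - a) < d"
    and bound: "\<And>x. norm x \<le> M \<Longrightarrow> norm (x - a) < d \<Longrightarrow> norm (g' x - g' a) \<le> B"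
  shows "norm (g b - g a - g' a (b - a)) \<le> norm (b - a) * B"
proof (rule differentiable_bound_linearization[of _ _ "closed_segment a b"])
  show "a + t *\<^sub>R (b - a) \<in> closed_segment a b" if "t \<in> {0..1}" for t
    using that by (auto simp: closed_segment_def algebra_simps intro!: exI[of _ t])
  show "(g has_derivative blinfun_apply (g' x)) (at x within closed_segment a b)" for x
    by (rule has_derivative_at_withinI[OF deriv])
  show "onorm (blinfun_apply (g' x) - blinfun_apply (g' a)) \<le> B" if "x \<in> closed_segment a b" for x
  proof -
    have "closed_segment a b \<subseteq> cball 0 M"
      using ab by (intro closed_segment_subset) auto
    then have "norm x \<le> M" using that by auto
    moreover have "norm (x - a) < d"
      using segment_bound(1)[OF that] ab(3) by simp
    ultimately have "norm (g' x - g' a) \<le> B" by (rule bound)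
    moreover have "blinfun_apply (g' x) - blinfun_apply (g' a) = blinfun_apply (g' x - g' a)"
      by (simp add: fun_eq_iff blinfun.diff_left)
    ultimately show ?thesis by (simp add: norm_blinfun.rep_eq)
  qed
qed simp

lemma japanese_bracket_powr_mono:
  assumes "\<beta> \<le> \<alpha>"
  shows "japanese_bracket x powr - \<alpha> \<le> japanese_bracket x powr - \<beta>"
  using assms japanese_bracket_ge_1[of x] by (intro powr_mono) auto

lemma japanese_bracket_decay_bound:
  fixes g :: "real^'n \<Rightarrow> 'a::real_normed_vector \<Rightarrow> 'b::real_normed_vector"
  assumes "\<And>M. M > 0 \<Longrightarrow> bdd_above {japanese_bracket x powr \<alpha> * norm (g x u) | x u. norm u \<le> M}"
  obtains D where "D \<ge> 0" "\<And>x u. norm u \<le> M \<Longrightarrow> norm (g x u) \<le> D * japanese_bracket x powr - \<alpha>"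
proof -
  \<comment> \<open>The assumption speaks of positive radii only, while \<open>M\<close> may be 0,
    as for the norm of the zero element; hence the radius \<open>\<bar>M\<bar> + 1\<close>.\<close>
  have "bdd_above {japanese_bracket x powr \<alpha> * norm (g x u) | x u. norm u \<le> \<bar>M\<bar> + 1}"
    by (rule assms) simp
  then obtain D where D: "\<And>x u. norm u \<le> \<bar>M\<bar> + 1 \<Longrightarrow> japanese_bracket x powr \<alpha> * norm (g x u) \<le> D"
    unfolding bdd_above_def by blast
  show ?thesis
  proof (rule that[of "max D 0"])
    fix x :: "real^'n" and u :: 'a assume "norm u \<le> M"
    then have "norm u \<le> \<bar>M\<bar> + 1" by linarith
    from D[OF this, of x] have "japanese_bracket x powr \<alpha> * norm (g x u) \<le> max D 0"
      by (simp add: le_max_iff_disj)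
    then have "japanese_bracket x powr - \<alpha> * (japanese_bracket x powr \<alpha> * norm (g x u)) \<le>
        japanese_bracket x powr - \<alpha> * max D 0"
      by (rule mult_left_mono) simp
    also have "japanese_bracket x powr - \<alpha> * (japanese_bracket x powr \<alpha> * norm (g x u)) = norm (g x u)"
      using japanese_bracket_ge_1[of x] by (simp add: mult.assoc[symmetric] powr_add[symmetric])
    finally show "norm (g x u) \<le> max D 0 * japanese_bracket x powr - \<alpha>"
      by (simp only: mult.commute)
  qed simp
qed

section \<open>Continuous differentiability of the integral operator\<close>

definition integral_operator :: "real \<Rightarrow> (real^'n \<Rightarrow> complex \<Rightarrow> complex) \<Rightarrow> (real^'n) linf \<Rightarrow> (real^'n) linf" where
  "integral_operator k f u = linf_resolvent k (substitution_op f (rep_linf u))"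

text \<open>Remainders and differences of derivatives are estimated at almost every \<open>y\<close>
  with the weight \<open>\<beta>\<close>, and \<open>norm_linf_resolvent\<close> converts this into
  norms. The last two conclusions describe \<open>F'\<close> and the operator through
  representatives: one yields \<open>F' 0 = 0\<close>, the other the link to
  \<open>is_solution\<close>.\<close>

lemma integral_operator_C1:
  fixes f :: "real ^ 'n \<Rightarrow> complex \<Rightarrow> complex"
    and f' :: "real ^ 'n \<Rightarrow> complex \<Rightarrow> (complex \<Rightarrow>\<^sub>L complex)"
  assumes res: "resolvent_bounded_by TYPE('n) k \<beta> C" and \<alpha>\<beta>: "0 \<le> \<beta>" "\<beta> < \<alpha>"
    and f_cont: "continuous_on UNIV (\<lambda>(x, u). f x u)"
    and f_bdd: "\<And>M. M > 0 \<Longrightarrow>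
      bdd_above {japanese_bracket x powr \<alpha> * cmod (f x u) | x u. cmod u \<le> M}"
    and deriv: "\<And>x u. (f x has_derivative blinfun_apply (f' x u)) (at u)"
    and f'_cont: "continuous_on UNIV (\<lambda>(x, u). f' x u)"
    and f'_bdd: "\<And>M. M > 0 \<Longrightarrow>
      bdd_above {japanese_bracket x powr \<alpha> * norm (f' x u) | x u. cmod u \<le> M}"
  shows "\<exists>F' :: (real^'n) linf \<Rightarrow> (real^'n) linf \<Rightarrow>\<^sub>L (real^'n) linf.
    (\<forall>u. (integral_operator k f has_derivative blinfun_apply (F' u)) (at u)) \<and> continuous_on UNIV F' \<and>
    (\<forall>u v. F' u v = linf_resolvent k (\<lambda>y. f' y (rep_linf u y) (rep_linf v y))) \<and>
    (\<forall>u. AE x in lebesgue. rep_linf (integral_operator k f u) x = resolvent k (substitution_op f (rep_linf u)) x)"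
proof -
  let ?F = "integral_operator k f"
  define L where "L u v = (\<lambda>y. f' y (rep_linf u y) (rep_linf v y))" for u v :: "(real^'n) linf"
  have C: "C \<ge> 0" by (rule resolvent_bounded_by_nonneg[OF res])
  have f_meas: "substitution_op f (rep_linf u) \<in> borel_measurable lebesgue" for u
    unfolding substitution_op_def
    by (rule continuous_image_lebesgue_measurable[OF f_cont]) measurable
  have L_meas [measurable]: "L u v \<in> borel_measurable lebesgue" for u v
  proof -
    have *: "continuous_on UNIV (\<lambda>(x, p). blinfun_apply (f' x (fst p)) (snd p))"
    proof -
      have "continuous_on UNIV (\<lambda>q::(real^'n) \<times> complex \<times> complex. (fst q, fst (snd q)))"
        by (intro continuous_intros)
      from continuous_on_compose[OF this continuous_on_subset[OF f'_cont subset_UNIV]]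
      have "continuous_on UNIV (\<lambda>q::(real^'n) \<times> complex \<times> complex. f' (fst q) (fst (snd q)))"
        by (simp add: o_def)
      then show ?thesis
        unfolding case_prod_beta by (intro continuous_intros)
    qed
    have "(\<lambda>y. (rep_linf u y, rep_linf v y)) \<in> borel_measurable lebesgue" by measurable
    from continuous_image_lebesgue_measurable[OF * this] show ?thesis by (simp add: L_def)
  qed
  have f_wb: "\<exists>c. weight_bounded \<beta> (substitution_op f (rep_linf u)) c" for u
  proof -
    obtain D where D: "D \<ge> 0" "\<And>x z. cmod z \<le> norm u \<Longrightarrow> cmod (f x z) \<le> D * japanese_bracket x powr - \<alpha>"
      using japanese_bracket_decay_bound[OF f_bdd] by metis
    have "AE y in lebesgue. cmod (f y (rep_linf u y)) \<le> D * japanese_bracket y powr - \<beta>"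
      using norm_linf_AE[of u]
    proof eventually_elim
      case (elim y)
      show ?case
        using D(2)[OF elim, of y] mult_left_mono[OF japanese_bracket_powr_mono[of \<beta> \<alpha> y] D(1)] \<alpha>\<beta> by simp
    qed
    then show ?thesis
      using f_meas[of u] D(1) by (auto simp: weight_bounded_def substitution_op_def)
  qed
  have L_diff_wb: "weight_bounded \<beta> (\<lambda>y. L u v y - L u' v y) (e * norm v)"
    if "e \<ge> 0" and ae: "AE y in lebesgue. norm (f' y (rep_linf u y) - f' y (rep_linf u' y)) \<le> e * japanese_bracket y powr - \<beta>"
    for u u' v e
  proof -
    have "AE y in lebesgue. cmod (L u v y - L u' v y) \<le> e * norm v * japanese_bracket y powr - \<beta>"
      using ae norm_linf_AE[of v]
    proof eventually_elim
      case (elim y)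
      have "cmod (L u v y - L u' v y) = cmod ((f' y (rep_linf u y) - f' y (rep_linf u' y)) (rep_linf v y))"
        by (simp add: L_def blinfun.diff_left)
      also have "\<dots> \<le> norm (f' y (rep_linf u y) - f' y (rep_linf u' y)) * cmod (rep_linf v y)"
        by (rule norm_blinfun)
      also have "\<dots> \<le> (e * japanese_bracket y powr - \<beta>) * norm v"
        using elim \<open>e \<ge> 0\<close> by (intro mult_mono) auto
      finally show ?case by (simp add: mult_ac)
    qed
    then show ?thesis using \<open>e \<ge> 0\<close> by (simp add: weight_bounded_def)
  qed
  have L_wb: "\<exists>D\<ge>0. \<forall>v. weight_bounded \<beta> (L u v) (D * norm v)" for u
  proof -
    obtain D where D: "D \<ge> 0" "\<And>x z. cmod z \<le> norm u \<Longrightarrow> norm (f' x z) \<le> D * japanese_bracket x powr - \<alpha>"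
      using japanese_bracket_decay_bound[OF f'_bdd] by metis
    have "AE y in lebesgue. cmod (L u v y) \<le> D * norm v * japanese_bracket y powr - \<beta>" for v
      using norm_linf_AE[of u] norm_linf_AE[of v]
    proof eventually_elim
      case (elim y)
      have "cmod (L u v y) \<le> norm (f' y (rep_linf u y)) * cmod (rep_linf v y)"
        unfolding L_def by (rule norm_blinfun)
      also have "\<dots> \<le> (D * japanese_bracket y powr - \<beta>) * norm v"
      proof (intro mult_mono elim)
        show "norm (f' y (rep_linf u y)) \<le> D * japanese_bracket y powr - \<beta>"
          using D(2)[OF elim(1), of y] mult_left_mono[OF japanese_bracket_powr_mono[of \<beta> \<alpha> y] D(1)] \<alpha>\<beta> by simp
      qed (use D in auto)
      finally show ?case by (simp add: mult_ac)
    qed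
    then show ?thesis using D(1) by (auto simp: weight_bounded_def)
  qed
  have "bounded_linear (\<lambda>v. linf_resolvent k (L u v))" for u
  proof -
    obtain D where D: "D \<ge> 0" "\<And>v. weight_bounded \<beta> (L u v) (D * norm v)"
      using L_wb[of u] by blast
    \<comment> \<open>Representatives of sums and multiples are additive and homogeneous only almost
      everywhere, so \<open>L u\<close> is linear only up to null sets, which the convolution does
      not see.\<close>
    have cong: "linf_resolvent k g = linf_resolvent k h"
      if "g \<in> borel_measurable lebesgue" "h \<in> borel_measurable lebesgue" "AE y in lebesgue. g y = h y"
      for g h :: "real^'n \<Rightarrow> complex"
      unfolding linf_resolvent_def using resolvent_cong_AE[OF res that] by simp
    show ?thesis
    proof (rule bounded_linear_intro[where K = "C * D"])
      fix v w :: "(real^'n) linf" and r :: real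
      have "linf_resolvent k (L u (v + w)) = linf_resolvent k (\<lambda>y. L u v y + L u w y)"
        by (rule cong) (measurable, use rep_linf_add[of v w] in eventually_elim, simp add: L_def blinfun.add_right)
      then show "linf_resolvent k (L u (v + w)) = linf_resolvent k (L u v) + linf_resolvent k (L u w)"
        using linf_resolvent_add[OF res D(2) D(2)] by simp
      have "linf_resolvent k (L u (r *\<^sub>R v)) = linf_resolvent k (\<lambda>y. r *\<^sub>R L u v y)"
        by (rule cong) (measurable, use rep_linf_scaleR[of r v] in eventually_elim, simp add: L_def blinfun.scaleR_right)
      then show "linf_resolvent k (L u (r *\<^sub>R v)) = r *\<^sub>R linf_resolvent k (L u v)"
        using linf_resolvent_scaleR[OF res D(2)] by simp
      show "norm (linf_resolvent k (L u v)) \<le> norm v * (C * D)"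
        using norm_linf_resolvent[OF res D(2)[of v]] by (simp add: mult_ac)
    qed
  qed
  define F' where "F' u = Blinfun (\<lambda>v. linf_resolvent k (L u v))" for u
  have F'_apply: "blinfun_apply (F' u) v = linf_resolvent k (L u v)" for u v
    unfolding F'_def using \<open>bounded_linear (\<lambda>v. linf_resolvent k (L u v))\<close>
    by (simp add: bounded_linear_Blinfun_apply)
  \<comment> \<open>The factor \<open>C\<close> of the resolvent bound will be absorbed by the
    division; \<open>C + 1\<close> is used since \<open>C\<close> may be 0.\<close>
  have modulus: "\<exists>d>0. \<forall>x a b. cmod a \<le> M \<longrightarrow> cmod b \<le> M \<longrightarrow> cmod (a - b) < d \<longrightarrow>
      norm (f' x a - f' x b) \<le> e / (C + 1) * japanese_bracket x powr - \<beta>" if "e > 0" for M e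
  proof -
    obtain D where D: "D \<ge> 0" "\<And>x z. cmod z \<le> M \<Longrightarrow> norm (f' x z) \<le> D * japanese_bracket x powr - \<alpha>"
      using japanese_bracket_decay_bound[OF f'_bdd] by metis
    have "e / (C + 1) > 0" using that C by simp
    from weighted_uniform_continuity[OF f'_cont \<alpha>\<beta> D(2) D(1) this] show ?thesis by metis
  qed
  have scale: "C * (e / (C + 1) * t) \<le> e * t" if "e > 0" "t \<ge> 0" for e t
  proof -
    have "C / (C + 1) * (e * t) \<le> 1 * (e * t)"
      using that C by (intro mult_right_mono) auto
    then show ?thesis by (simp add: mult_ac)
  qed
  have F'_close: "\<exists>d>0. \<forall>u'. norm (u' - u) < d \<longrightarrow> norm (F' u' - F' u) \<le> e" if "e > 0" for u e
  proof -
    obtain d where d: "d > 0" "\<And>x a b. cmod a \<le> norm u + 1 \<Longrightarrow> cmod b \<le> norm u + 1 \<Longrightarrow> cmod (a - b) < d \<Longrightarrow>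
      norm (f' x a - f' x b) \<le> e / (C + 1) * japanese_bracket x powr - \<beta>"
      using modulus[OF \<open>e > 0\<close>, of "norm u + 1"] by blast
    \<comment> \<open>The 1 in the minimum keeps \<open>u'\<close> in the ball of radius
      \<open>norm u + 1\<close> for which \<open>d\<close> was chosen.\<close>
    have "norm (F' u' - F' u) \<le> e" if u': "norm (u' - u) < min d 1" for u'
    proof (rule norm_blinfun_bound)
      fix v
      obtain D where D: "\<And>v. weight_bounded \<beta> (L u v) (D * norm v)" using L_wb[of u] by blast
      obtain D' where D': "\<And>v. weight_bounded \<beta> (L u' v) (D' * norm v)" using L_wb[of u'] by blast
      have u'_le: "norm u' \<le> norm u + 1"
        using u' norm_triangle_ineq2[of u' u] by simp
      have "AE y in lebesgue. norm (f' y (rep_linf u' y) - f' y (rep_linf u y)) \<le>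
          e / (C + 1) * japanese_bracket y powr - \<beta>"
        using norm_linf_AE[of u] norm_linf_AE[of u'] norm_linf_AE[of "u' - u"] rep_linf_diff[of u' u]
        by eventually_elim (rule d(2); use u' u'_le in simp)
      then have "weight_bounded \<beta> (\<lambda>y. L u' v y - L u v y) (e / (C + 1) * norm v)"
        using \<open>e > 0\<close> C by (intro L_diff_wb) auto
      then have "norm (linf_resolvent k (\<lambda>y. L u' v y - L u v y)) \<le> C * (e / (C + 1) * norm v)"
        by (rule norm_linf_resolvent[OF res])
      also have "\<dots> \<le> e * norm v" using \<open>e > 0\<close> by (intro scale) auto
      also have "linf_resolvent k (\<lambda>y. L u' v y - L u v y) = (F' u' - F' u) v"
        by (simp add: linf_resolvent_diff[OF res D' D] blinfun.diff_left F'_apply)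
      finally show "norm ((F' u' - F' u) v) \<le> e * norm v" .
    qed (use \<open>e > 0\<close> in simp)
    then show ?thesis using d(1) by (intro exI[of _ "min d 1"]) auto
  qed
  have F_deriv: "(?F has_derivative blinfun_apply (F' u)) (at u)" for u
    unfolding has_derivative_at_alt
  proof (intro conjI allI impI)
    fix e :: real assume e: "e > 0"
    obtain d where d: "d > 0" "\<And>x a b. cmod a \<le> norm u + 1 \<Longrightarrow> cmod b \<le> norm u + 1 \<Longrightarrow> cmod (a - b) < d \<Longrightarrow>
      norm (f' x a - f' x b) \<le> e / (C + 1) * japanese_bracket x powr - \<beta>"
      using modulus[OF \<open>e > 0\<close>, of "norm u + 1"] by blast
    have "norm (?F v - ?F u - F' u (v - u)) \<le> e * norm (v - u)" if v: "norm (v - u) < min d 1" for v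
    proof -
      obtain cu cv where wb: "weight_bounded \<beta> (substitution_op f (rep_linf u)) cu"
        "weight_bounded \<beta> (substitution_op f (rep_linf v)) cv"
        using f_wb by blast
      obtain D where D: "weight_bounded \<beta> (L u (v - u)) D" using L_wb[of u] by blast
      define h where "h y = substitution_op f (rep_linf v) y - substitution_op f (rep_linf u) y - L u (v - u) y" for y
      have "weight_bounded \<beta> (\<lambda>y. substitution_op f (rep_linf v) y - substitution_op f (rep_linf u) y) (cv + \<bar>-1\<bar> * cu)"
        using weight_bounded_add[OF wb(2) weight_bounded_scaleR[OF wb(1), of "- 1"]] by simp
      then have "linf_resolvent k h = ?F v - ?F u - F' u (v - u)"
        unfolding h_def[abs_def] integral_operator_def F'_apply
        by (simp add: linf_resolvent_diff[OF res _ D] linf_resolvent_diff[OF res wb(2) wb(1)])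
      moreover have "weight_bounded \<beta> h (e / (C + 1) * norm (v - u))"
        unfolding weight_bounded_def
      proof (intro conjI)
        show "h \<in> borel_measurable lebesgue"
          using f_meas[of u] f_meas[of v] unfolding h_def[abs_def] by measurable
        show "0 \<le> e / (C + 1) * norm (v - u)" using e C by simp
        have v_le: "norm v \<le> norm u + 1"
          using v norm_triangle_ineq2[of v u] by simp
        show "AE y in lebesgue. cmod (h y) \<le> e / (C + 1) * norm (v - u) * japanese_bracket y powr - \<beta>"
          using norm_linf_AE[of u] norm_linf_AE[of v] norm_linf_AE[of "v - u"] rep_linf_diff[of v u]
        proof eventually_elim
          case (elim y)
          define a b where "a = rep_linf u y" and "b = rep_linf v y"
          have ab: "cmod a \<le> norm u + 1" "cmod b \<le> norm u + 1" "cmod (b - a) \<le> norm (v - u)"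
            using elim v_le by (simp_all add: a_def b_def)
          have "cmod (f y b - f y a - f' y a (b - a)) \<le> cmod (b - a) * (e / (C + 1) * japanese_bracket y powr - \<beta>)"
          proof (rule linearization_error_bound[OF deriv ab(1,2)])
            show "cmod (b - a) < d" using ab(3) v by simp
            show "norm (f' y x - f' y a) \<le> e / (C + 1) * japanese_bracket y powr - \<beta>"
              if "cmod x \<le> norm u + 1" "cmod (x - a) < d" for x
              using that ab by (intro d(2))
          qed
          also have "\<dots> \<le> norm (v - u) * (e / (C + 1) * japanese_bracket y powr - \<beta>)"
            using ab(3) e C by (intro mult_right_mono) auto
          finally show ?case
            using elim(4) by (simp add: h_def substitution_op_def L_def a_def b_def mult_ac)
        qed
      qed
      ultimately have "norm (?F v - ?F u - F' u (v - u)) \<le> C * (e / (C + 1) * norm (v - u))"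
        using norm_linf_resolvent[OF res] by metis
      also have "\<dots> \<le> e * norm (v - u)" using e by (intro scale) auto
      finally show ?thesis .
    qed
    then show "\<exists>d>0. \<forall>v. norm (v - u) < d \<longrightarrow> norm (?F v - ?F u - F' u (v - u)) \<le> e * norm (v - u)"
      using d(1) by (intro exI[of _ "min d 1"]) auto
  qed (rule blinfun.bounded_linear_right)
  show ?thesis
  proof (intro exI[of _ F'] conjI allI)
    show "(?F has_derivative blinfun_apply (F' u)) (at u)" for u by (rule F_deriv)
    show "blinfun_apply (F' u) v = linf_resolvent k (\<lambda>y. f' y (rep_linf u y) (rep_linf v y))" for u v
      unfolding F'_apply L_def ..
    show "AE x in lebesgue. rep_linf (?F u) x = resolvent k (substitution_op f (rep_linf u)) x" for u
      unfolding integral_operator_def using f_wb[of u] rep_linf_resolvent[OF res] by blast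
    show "continuous_on UNIV F'"
      unfolding continuous_on_iff
    proof (intro ballI allI impI)
      fix u and e :: real assume "e > 0"
      then obtain d where "d > 0" "\<And>u'. norm (u' - u) < d \<Longrightarrow> norm (F' u' - F' u) \<le> e / 2"
        using F'_close[of "e / 2" u] by auto
      with \<open>e > 0\<close> show "\<exists>d>0. \<forall>u'\<in>UNIV. dist u' u < d \<longrightarrow> dist (F' u') (F' u) < e"
        by (intro exI[of _ d]) (fastforce simp: dist_norm)
    qed
  qed
qed

theorem theorem1p4:
  fixes k \<alpha> :: real
    and f :: "real ^ 'n \<Rightarrow> complex \<Rightarrow> complex"
    and f' :: "real ^ 'n \<Rightarrow> complex \<Rightarrow> (complex \<Rightarrow>\<^sub>L complex)"
  assumes "CARD('n) \<ge> 3" and "k > 0" and "\<alpha> > (real CARD('n) + 1) / 2"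
    and "continuous_on UNIV (\<lambda>(x, u). f x u)"
    and "\<And>M. M > 0 \<Longrightarrow>
      bdd_above {japanese_bracket x powr \<alpha> * cmod (f x u) | x u. cmod u \<le> M}"
    and "\<And>x u. (f x has_derivative blinfun_apply (f' x u)) (at u)"
    and "continuous_on UNIV (\<lambda>(x, u). f' x u)"
    and "\<And>M. M > 0 \<Longrightarrow>
      bdd_above {japanese_bracket x powr \<alpha> * norm (f' x u) | x u. cmod u \<le> M}"
    and "\<And>x. f x 0 = 0" and "\<And>x. f' x 0 = 0"
  shows "\<exists>U V :: (real ^ 'n) linf set.
    open U \<and> 0 \<in> U \<and> open V \<and> 0 \<in> V \<and>
    (\<forall>\<phi>\<in>V. \<exists>!u. u \<in> U \<and> is_solution k f \<phi> u) \<and>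
    C1_map_on V (\<lambda>\<phi>. THE u. u \<in> U \<and> is_solution k f \<phi> u)"
proof -
  \<comment> \<open>The midpoint lies strictly above the integrability threshold and strictly below
    \<open>\<alpha>\<close>, as the kernel bound and the tail estimate require.\<close>
  define \<beta> where "\<beta> = (\<alpha> + (real CARD('n) + 1) / 2) / 2"
  have \<beta>: "\<beta> > (real CARD('n) + 1) / 2" "\<beta> < \<alpha>" using assms(3) by (auto simp: \<beta>_def field_simps)
  have "0 \<le> \<beta>" by (rule order_trans[OF _ less_imp_le[OF \<beta>(1)]]) simp
  obtain C where "C \<ge> 0" "\<And>x::real^'n. (\<integral>\<^sup>+y. ennreal (cmod (helmholtz_\<Phi> k (x - y)) * japanese_bracket y powr - \<beta>) \<partial>lborel) \<le> ennreal C"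
    using weighted_potential_bound[OF assms(2,1) \<beta>(1)] by blast
  then have res: "resolvent_bounded_by TYPE('n) k \<beta> C"
    unfolding resolvent_bounded_by_def using borel_measurable_helmholtz_\<Phi>[OF assms(2,1)] by blast
  let ?F = "integral_operator k f"
  obtain F' :: "(real^'n) linf \<Rightarrow> (real^'n) linf \<Rightarrow>\<^sub>L (real^'n) linf" where F':
    "\<And>u. (?F has_derivative blinfun_apply (F' u)) (at u)" "continuous_on UNIV F'"
    "\<And>u v. F' u v = linf_resolvent k (\<lambda>y. f' y (rep_linf u y) (rep_linf v y))"
    "\<And>u. AE x in lebesgue. rep_linf (?F u) x = resolvent k (substitution_op f (rep_linf u)) x"
    using integral_operator_C1[OF res \<open>0 \<le> \<beta>\<close> \<beta>(2) assms(4-8)] by blast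
  have null: "linf_resolvent k h = 0" if "h \<in> borel_measurable lebesgue" "AE y in lebesgue. h y = 0" for h :: "real^'n \<Rightarrow> complex"
  proof -
    have "weight_bounded \<beta> h 0" using that by (auto simp: weight_bounded_def)
    then show ?thesis using norm_linf_resolvent[OF res] by fastforce
  qed
  have rep0: "AE y in lebesgue. rep_linf (0 :: (real^'n) linf) y = 0" by (rule rep_linf_zero)
  have F0: "?F 0 = 0"
    unfolding integral_operator_def
  proof (rule null)
    show "substitution_op f (rep_linf 0) \<in> borel_measurable lebesgue"
      unfolding substitution_op_def
      by (rule continuous_image_lebesgue_measurable[OF assms(4)]) measurable
    show "AE y in lebesgue. substitution_op f (rep_linf 0) y = 0"
      using rep0 by eventually_elim (simp add: substitution_op_def assms)
  qed
  have F'0: "F' 0 = 0"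
  proof (rule blinfun_eqI)
    fix v
    have ae: "AE y in lebesgue. f' y (rep_linf 0 y) (rep_linf v y) = 0"
      using rep0 by eventually_elim (simp add: assms)
    have "(\<lambda>y. blinfun_apply (f' y (rep_linf 0 y)) (rep_linf v y)) \<in> borel_measurable lebesgue"
      by (rule borel_measurable_AE[OF borel_measurable_const[of 0]]) (use ae in eventually_elim, simp)
    from null[OF this ae] show "blinfun_apply (F' 0) v = blinfun_apply 0 v"
      by (simp add: F'(3))
  qed
  \<comment> \<open>Equality of representatives almost everywhere is equality in the quotient, so
    the equation becomes a fixed point problem in the Banach space.\<close>
  have sol_iff: "is_solution k f \<phi> u \<longleftrightarrow> u = ?F u + \<phi>" for \<phi> u
  proof
    assume "is_solution k f \<phi> u"
    then have "AE x in lebesgue. rep_linf u x = resolvent k (substitution_op f (rep_linf u)) x + rep_linf \<phi> x"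
      by (simp add: is_solution_def)
    then show "u = ?F u + \<phi>"
      using F'(4)[of u] rep_linf_add[of "?F u" \<phi>] by (intro linf_eqI, eventually_elim) simp
  next
    assume u: "u = ?F u + \<phi>"
    have "AE x in lebesgue. rep_linf u x = rep_linf (?F u + \<phi>) x" using u[symmetric] by simp
    then show "is_solution k f \<phi> u"
      unfolding is_solution_def using F'(4)[of u] rep_linf_add[of "?F u" \<phi>] by eventually_elim simp
  qed
  obtain U V g g' where UV: "open U" "0 \<in> U" "open V" "0 \<in> V"
    "\<And>\<phi> u. \<phi> \<in> V \<Longrightarrow> (u \<in> U \<and> u = ?F u + \<phi>) \<longleftrightarrow> u = g \<phi>"
    "\<And>\<phi>. \<phi> \<in> V \<Longrightarrow> (g has_derivative blinfun_apply (g' \<phi> :: (real^'n) linf \<Rightarrow>\<^sub>L (real^'n) linf)) (at \<phi>)"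
    "continuous_on V g'"
    using local_C1_solution[OF F'(1,2) F0 F'0] by blast
  have "(THE u. u \<in> U \<and> is_solution k f \<phi> u) = g \<phi>" if "\<phi> \<in> V" for \<phi>
    using UV(5)[OF that] by (simp add: sol_iff)
  \<comment> \<open>The description operator is known to agree with \<open>g\<close> on
    \<open>V\<close> only; since \<open>V\<close> is open, derivatives carry over.\<close>
  then have "((\<lambda>\<phi>. THE u. u \<in> U \<and> is_solution k f \<phi> u) has_derivative blinfun_apply (g' \<phi>)) (at \<phi>)"
    if "\<phi> \<in> V" for \<phi>
    using that by (intro has_derivative_transform_within_open[OF UV(6)[OF that] UV(3) that]) simp
  then have "C1_map_on V (\<lambda>\<phi>. THE u. u \<in> U \<and> is_solution k f \<phi> u)"
    unfolding C1_map_on_def using UV(7) by blast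
  moreover have "\<exists>!u. u \<in> U \<and> is_solution k f \<phi> u" if "\<phi> \<in> V" for \<phi>
    using UV(5)[OF that] by (simp add: sol_iff)
  ultimately show ?thesis by (intro exI[of _ U] exI[of _ V] conjI ballI UV(1-4))
qed

end
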